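(* Let $P \subseteq \mathbb{R}^n$ be a polyhedron, and let $P = Q + C$ denote the Minkowski sum $\{q + c \mid q \in Q, c \in C\}$. (1) If $P$ is an L$^\natural$-convex polyhedron, then $P = Q + C$ for some bounded L$^\natural$-convex polyhedron $Q$ and some L$^\natural$-convex cone $C$. (2) If $P$ is an L$^\natural_2$-convex polyhedron, then $P = Q + C$ for some bounded L$^\natural_2$-convex polyhedron $Q$ and some L$^\natural_2$-convex cone $C$. (3) If $P$ is an M$^\natural$-convex polyhedron, then $P = Q + C$ for some bounded M$^\natural$-convex polyhedron $Q$ and some M$^\natural$-convex cone $C$. Similarly, if $P$ is an M-convex polyhedron, then $P = Q + C$ for some bounded M-convex polyhedron $Q$ and some M-convex cone $C$. (4) If $P$ is an M$^\natural_2$-convex polyhedron, then $P = Q + C$ for some bounded M$^\natural_2$-convex polyhedron $Q$ and some M$^\natural_2$-convex cone $C$. Similarly, if $P$ is an M$_2$-convex polyhedron, then $P = Q + C$ for some bounded M$_2$-convex polyhedron $Q$ and some M$_2$-convex cone $C$. (5) If $P$ is a multimodular polyhedron, then $P = Q + C$ for some bounded multimodular polyhedron $Q$ and some multimodular cone $C$.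
   Context: All sets below are nonempty; $e_i$ denotes the $i$-th unit vector, and $\lceil\cdot\rceil$, $\lfloor\cdot\rfloor$ act componentwise. A set $S \subseteq \mathbb{Z}^n$ is L$^\natural$-convex if for all $p,q \in S$ both $\lceil (p+q)/2 \rceil$ and $\lfloor (p+q)/2 \rfloor$ belong to $S$. A set is L$^\natural_2$-convex if it is the Minkowski sum of two L$^\natural$-convex sets. A set $S \subseteq \mathbb{Z}^n$ is M$^\natural$-convex if for all $x,y \in S$ and every $i$ with $x_i > y_i$, either ($x - e_i \in S$ and $y + e_i \in S$) or there exists $j$ with $x_j < y_j$ such that $x - e_i + e_j \in S$ and $y + e_i - e_j \in S$. A set $S \subseteq \mathbb{Z}^n$ is M-convex if for all $x,y \in S$ and every $i$ with $x_i > y_i$ there exists $j$ with $x_j < y_j$ such that $x - e_i + e_j \in S$ and $y + e_i - e_j \in S$. A set is M$^\natural_2$-convex (resp. M$_2$-convex) if it is the intersection of two M$^\natural$-convex (resp. M-convex) sets. A set $S \subseteq \mathbb{Z}^n$ is multimodular if $S = \{Dy \mid y \in T\}$ for some L$^\natural$-convex set $T$, where $D$ is the $n\times n$ matrix with $D_{ii} = 1$, $D_{i+1,i} = -1$ and all other entries $0$. For each such class "A" (L$^\natural$, L$^\natural_2$, M$^\natural$, M, M$^\natural_2$, M$_2$, multimodular), an A-convex polyhedron is the convex hull of an A-convex set, and an A-convex cone is an A-convex polyhedron that is a cone (a set closed under multiplication by nonnegative scalars). *)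

theory Defs
  imports "HOL-Analysis.Analysis"
begin

definition ceil_mid :: "int ^ 'n \<Rightarrow> int ^ 'n \<Rightarrow> int ^ 'n" where
  "ceil_mid p q = (\<chi> i. \<lceil>(real_of_int (p $ i) + real_of_int (q $ i)) / 2\<rceil>)"

definition floor_mid :: "int ^ 'n \<Rightarrow> int ^ 'n \<Rightarrow> int ^ 'n" where
  "floor_mid p q = (\<chi> i. \<lfloor>(real_of_int (p $ i) + real_of_int (q $ i)) / 2\<rfloor>)"

definition Lnat_convex :: "(int ^ 'n) set \<Rightarrow> bool" where
  "Lnat_convex S \<longleftrightarrow> S \<noteq> {} \<and> (\<forall>p\<in>S. \<forall>q\<in>S. ceil_mid p q \<in> S \<and> floor_mid p q \<in> S)"

definition Lnat2_convex :: "(int ^ 'n) set \<Rightarrow> bool" where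
  "Lnat2_convex S \<longleftrightarrow>
     (\<exists>T U. Lnat_convex T \<and> Lnat_convex U \<and> S = {t + u | t u. t \<in> T \<and> u \<in> U})"

definition Mnat_convex :: "(int ^ 'n) set \<Rightarrow> bool" where
  "Mnat_convex S \<longleftrightarrow> S \<noteq> {} \<and>
     (\<forall>x\<in>S. \<forall>y\<in>S. \<forall>i. x $ i > y $ i \<longrightarrow>
        (x - axis i 1 \<in> S \<and> y + axis i 1 \<in> S) \<or>
        (\<exists>j. x $ j < y $ j \<and> x - axis i 1 + axis j 1 \<in> S \<and> y + axis i 1 - axis j 1 \<in> S))"

definition M_convex :: "(int ^ 'n) set \<Rightarrow> bool" where
  "M_convex S \<longleftrightarrow> S \<noteq> {} \<and>
     (\<forall>x\<in>S. \<forall>y\<in>S. \<forall>i. x $ i > y $ i \<longrightarrow>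
        (\<exists>j. x $ j < y $ j \<and> x - axis i 1 + axis j 1 \<in> S \<and> y + axis i 1 - axis j 1 \<in> S))"

definition Mnat2_convex :: "(int ^ 'n) set \<Rightarrow> bool" where
  "Mnat2_convex S \<longleftrightarrow>
     S \<noteq> {} \<and> (\<exists>T U. Mnat_convex T \<and> Mnat_convex U \<and> S = T \<inter> U)"

definition M2_convex :: "(int ^ 'n) set \<Rightarrow> bool" where
  "M2_convex S \<longleftrightarrow>
     S \<noteq> {} \<and> (\<exists>T U. M_convex T \<and> M_convex U \<and> S = T \<inter> U)"

text \<open>
  The coordinates \<open>1, \<dots>, n\<close> are the elements of a finite linearly ordered index type in increasing
  order, so ``\<open>i\<close> is \<open>j + 1\<close>'' means that \<open>i\<close> is the immediate successor of \<open>j\<close>.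
  The row index of \<open>multimodular_matrix $ i $ j\<close> is \<open>i\<close>.
\<close>

definition multimodular_matrix :: "int ^ ('n::{finite,linorder}) ^ ('n::{finite,linorder})" where
  "multimodular_matrix = (\<chi> i j.
     if i = j then 1 else if j < i \<and> \<not> (\<exists>k. j < k \<and> k < i) then -1 else 0)"

definition multimodular :: "(int ^ 'n::{finite,linorder}) set \<Rightarrow> bool" where
  "multimodular S \<longleftrightarrow> (\<exists>T. Lnat_convex T \<and> S = {multimodular_matrix *v y | y. y \<in> T})"

definition real_vec :: "int ^ 'n \<Rightarrow> real ^ 'n" where
  "real_vec x = (\<chi> i. real_of_int (x $ i))"

text \<open>
  The parameter \<open>A\<close> is one of the classes of integer sets above. All of them consist of nonempty
  sets, so the polyhedra and cones below are nonempty as well; the library's \<^const>\<open>cone\<close> alone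
  would admit the empty set.
\<close>

definition convex_polyhedron_of :: "((int ^ 'n) set \<Rightarrow> bool) \<Rightarrow> (real ^ 'n) set \<Rightarrow> bool" where
  "convex_polyhedron_of A P \<longleftrightarrow> (\<exists>S. A S \<and> P = convex hull (real_vec ` S))"

definition convex_cone_of :: "((int ^ 'n) set \<Rightarrow> bool) \<Rightarrow> (real ^ 'n) set \<Rightarrow> bool" where
  "convex_cone_of A C \<longleftrightarrow> convex_polyhedron_of A C \<and> cone C"

end

theory Submission imports Defs begin

text \<open>
  A polyhedron is the sum of the convex hull of finitely many of its points and its recession cone.
  If \<open>P\<close> is the hull of a set \<open>S\<close> of integer points, then those finitely many points are convex
  combinations of points of \<open>S\<close> in a large box, and intersecting with a box preserves the classes in
  question; so it suffices to show that the recession cone is the hull of an integer set of the class.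

  An L-natural-convex set consists of the integer points satisfying its tight bounds on coordinates and
  coordinate differences. Its hull satisfies the same real inequalities, because a real solution is an
  average of roundings, and the recession cone is the hull of the integer solutions of the homogeneous
  system, because a real solution is a nonnegative combination of signed indicators of its level sets.
  Sums of two such sets and multimodular sets follow by linearity.

  For an M-natural-convex set, an extra coordinate turns the exchange axiom into exchange of units between
  two coordinates. The recession cone is generated by those differences of two unit vectors along which
  one can move forever: otherwise Farkas' lemma yields a set \<open>X\<close> of coordinates whose sum is unbounded
  although no such direction leads into \<open>X\<close>, contradicting the exchange property at a suitable closest point.
  The integer points of this cone are net flows, hence M-natural-convex. For an intersection, Dirichlet
  approximation shows that the intersection of two such cones is the hull of their common integer flows.
\<close>

section \<open>Recession cones of polyhedra\<close>

text \<open>The two families need dual devices. L-natural-convex sets are given by finitely many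
  inequalities, so their hulls are shown to be polyhedra and the recession cone is read off. For
  M-natural-convex sets generators are computed instead, and polyhedrality of the hull is assumed;
  it lets a single ray of lattice points decide membership in the recession cone.

  The obstacle is the intersection of two M-natural-convex sets, which need not satisfy an exchange
  axiom. Every argument about directions is therefore made for \<open>T\<close> and \<open>U\<close>
  separately, from a common base point \<open>x\<close>. One inclusion uses only that the hull of
  \<open>T \<inter> U\<close> lies in both hulls. The other returns to lattice points: an integral
  flow admissible for both sets moves \<open>x\<close> inside \<open>T\<close> and inside
  \<open>U\<close>, since an integral point in the hull of an M-natural-convex set belongs to the
  set.

  The extra coordinate \<open>None\<close> has two roles: on the L side it is factored out together
  with the all-one direction, on the M side it restores a zero coordinate sum.\<close>

definition recession :: "'a::real_vector set \<Rightarrow> 'a set" where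
  "recession P = {d. \<forall>x\<in>P. \<forall>t\<ge>0. x + t *\<^sub>R d \<in> P}"

lemma recession_add:
  "c \<in> recession P \<Longrightarrow> d \<in> recession P \<Longrightarrow> c + d \<in> recession P"
  by (simp add: recession_def scaleR_add_right flip: add.assoc)

lemma recession_scaleR: "d \<in> recession P \<Longrightarrow> 0 \<le> t \<Longrightarrow> t *\<^sub>R d \<in> recession P"
  by (simp add: recession_def)

lemma convex_cone_recession: "convex_cone (recession P)"
proof -
  have "0 \<in> recession P" by (simp add: recession_def)
  then show ?thesis
    by (auto simp: convex_cone_iff recession_add recession_scaleR)
qed

lemma recessionD_scaleR:
  "d \<in> recession P \<Longrightarrow> x \<in> P \<Longrightarrow> 0 \<le> t \<Longrightarrow> x + t *\<^sub>R d \<in> P"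
  by (simp add: recession_def)

lemma recessionD: "d \<in> recession P \<Longrightarrow> x \<in> P \<Longrightarrow> x + d \<in> P"
  using recessionD_scaleR[of d P x 1] by simp

lemma affine_bounded_imp_nonpos:
  fixes s c r :: real
  assumes "\<And>k::nat. c + real k * s \<le> r"
  shows "s \<le> 0"
proof (rule ccontr)
  assume "\<not> s \<le> 0"
  then obtain k :: nat where "real k * s > r - c"
    using reals_Archimedean3[of s] by auto
  with assms[of k] show False by simp
qed

text \<open>A linear functional bounded above along the integer multiples of \<open>d\<close> has
  nonpositive slope, and this suffices for every base point and every real step. Integer steps
  matter because lattice points only supply natural multiples.\<close>

lemma recession_halfspaces:
  fixes a :: "'i \<Rightarrow> 'a::real_inner"
  assumes P: "P = {x. \<forall>i\<in>I. a i \<bullet> x \<le> b i}" and "x \<in> P"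
    and "\<And>k::nat. x + real k *\<^sub>R d \<in> P"
  shows "d \<in> recession P"
proof -
  have *: "a i \<bullet> d \<le> 0" if "i \<in> I" for i
  proof (rule affine_bounded_imp_nonpos)
    show "a i \<bullet> x + real k * (a i \<bullet> d) \<le> b i" for k
      using assms(3)[of k] that by (simp add: P inner_right_distrib)
  qed
  have "y + t *\<^sub>R d \<in> P" if "y \<in> P" "t \<ge> 0" for y t
    using that * by (auto simp: P inner_right_distrib intro!: add_nonpos_nonpos add_decreasing2 mult_nonneg_nonpos)
  then show ?thesis by (simp add: recession_def)
qed

lemma polyhedron_halfspaces:
  fixes P :: "'a::euclidean_space set"
  assumes "polyhedron P"
  obtains F :: "'a set set" and a b
  where "finite F" "P = {x. \<forall>h\<in>F. a h \<bullet> x \<le> b h}"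
proof -
  obtain F where F: "finite F" "P = \<Inter> F" "\<forall>h \<in> F. \<exists>a b. a \<noteq> 0 \<and> h = {x. a \<bullet> x \<le> b}"
    using assms unfolding polyhedron_def by blast
  then obtain a b where "\<And>h. h \<in> F \<Longrightarrow> h = {x. a h \<bullet> x \<le> b h}" by metis
  then have "P = {x. \<forall>h\<in>F. a h \<bullet> x \<le> b h}"
    using F(2) by fastforce
  from that[OF F(1) this] show thesis .
qed

lemma polyhedron_recessionI:
  fixes P :: "'a::euclidean_space set"
  assumes "polyhedron P" "x \<in> P" "\<And>k::nat. x + real k *\<^sub>R d \<in> P"
  shows "d \<in> recession P"
proof -
  obtain F :: "'a set set" and a b where "P = {x. \<forall>h\<in>F. a h \<bullet> x \<le> b h}"
    using polyhedron_halfspaces[OF assms(1)] .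
  from recession_halfspaces[OF this assms(2,3)] show ?thesis .
qed

text \<open>A limit of the normalised points of a sequence escaping to infinity is such a direction:
  dividing a constraint by the norm sends its right-hand side to 0.\<close>

lemma unbounded_polyhedron_recession:
  fixes P :: "'a::euclidean_space set"
  assumes P: "P = {x. \<forall>i\<in>I. a i \<bullet> x \<le> b i}" and "\<not> bounded P"
  obtains d where "d \<noteq> 0" "\<And>i. i \<in> I \<Longrightarrow> a i \<bullet> d \<le> 0"
proof -
  have "\<exists>x\<in>P. norm x > real n" for n :: nat
    using \<open>\<not> bounded P\<close> unfolding bounded_iff by (meson not_le)
  then obtain x where x: "\<And>n. x n \<in> P" "\<And>n. norm (x n) > real n" by metis
  define y where "y n = x n /\<^sub>R norm (x n)" for n
  have nz: "norm (x n) > 0" for n using x(2)[of n] by (meson le_less_trans of_nat_0_le_iff)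
  then have "y n \<in> sphere 0 1" for n by (simp add: y_def)
  then obtain d r where d: "d \<in> sphere 0 1" "strict_mono r" "(y \<circ> r) \<longlonglongrightarrow> d"
    using compact_sphere unfolding compact_def by metis
  have "a i \<bullet> d \<le> 0" if i: "i \<in> I" for i
  proof (rule LIMSEQ_le)
    show "(\<lambda>n. a i \<bullet> (y \<circ> r) n) \<longlonglongrightarrow> a i \<bullet> d" by (intro tendsto_intros d)
    show "(\<lambda>n. \<bar>b i\<bar> * inverse (real n)) \<longlonglongrightarrow> 0"
      using tendsto_mult[OF tendsto_const lim_inverse_n] by fastforce
    have "a i \<bullet> y (r n) \<le> \<bar>b i\<bar> * inverse (real n)" if "n \<ge> 1" for n
    proof -
      have "real n < norm (x (r n))"
        using x(2)[of "r n"] seq_suble[OF d(2), of n] by (meson le_less_trans of_nat_mono)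
      then have "inverse (norm (x (r n))) \<le> inverse (real n)" using that by (simp add: le_imp_inverse_le)
      moreover have "a i \<bullet> y (r n) = inverse (norm (x (r n))) * (a i \<bullet> x (r n))" by (simp add: y_def)
      moreover have "\<dots> \<le> inverse (norm (x (r n))) * \<bar>b i\<bar>"
        using x(1)[of "r n"] i nz[of "r n"] unfolding P
        by (intro mult_left_mono) (fastforce intro: order_trans[OF _ abs_ge_self])+
      ultimately show ?thesis
        by (smt (verit) abs_ge_zero mult.commute mult_left_mono)
    qed
    then show "\<exists>N. \<forall>n\<ge>N. a i \<bullet> (y \<circ> r) n \<le> \<bar>b i\<bar> * inverse (real n)" by (auto intro!: exI[of _ 1])
  qed
  moreover have "d \<noteq> 0" using d(1) by auto
  ultimately show thesis using that by blast
qed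

lemma aff_dim_Int_hyperplane_less:
  fixes P :: "'a::euclidean_space set"
  assumes "P \<inter> {x. c \<bullet> x = r} \<noteq> {}" "\<not> P \<subseteq> {x. c \<bullet> x = r}"
  shows "aff_dim (P \<inter> {x. c \<bullet> x = r}) < aff_dim P"
proof (rule ccontr)
  let ?P = "P \<inter> {x. c \<bullet> x = r}"
  assume "\<not> ?thesis"
  then have "aff_dim ?P = aff_dim P"
    using aff_dim_subset[of ?P P] by auto
  then have "affine hull ?P = affine hull P"
    using assms(1) by (intro affine_dim_equal) (simp_all add: hull_mono)
  moreover have "affine hull ?P \<subseteq> {x. c \<bullet> x = r}"
    by (intro hull_minimal affine_hyperplane) auto
  ultimately show False
    using assms(2) hull_subset[of P affine] by auto
qed

text \<open>Induction on the affine dimension: every point is slid along the line of a nonzero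
  recession direction into one of finitely many lower-dimensional slices. The added 1 accounts for
  the empty set, whose affine dimension is -1.\<close>

theorem polyhedron_subset_hull_plus_recession:
  fixes P :: "'a::euclidean_space set"
  assumes "polyhedron P"
  shows "\<exists>V. finite V \<and> V \<subseteq> P \<and> P \<subseteq> convex hull V + recession P"
  using assms
proof (induction "nat (aff_dim P + 1)" arbitrary: P rule: less_induct)
  case less
  obtain F :: "'a set set" and a b where F: "finite F" and P: "P = {x. \<forall>i\<in>F. a i \<bullet> x \<le> b i}"
    using polyhedron_halfspaces[OF \<open>polyhedron P\<close>] .
  have recI: "d \<in> recession P" if "\<And>i. i \<in> F \<Longrightarrow> a i \<bullet> d \<le> 0" for d
    using that unfolding recession_def P
    by (auto simp: inner_right_distrib intro!: add_nonpos_nonpos add_decreasing2 mult_nonneg_nonpos)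
  have slice: "\<exists>V. finite V \<and> V \<subseteq> P \<and> P \<inter> {x. c \<bullet> x = r} \<subseteq> convex hull V + recession P"
    if "\<not> P \<subseteq> {x. c \<bullet> x = r}" for c r
  proof (cases "P \<inter> {x. c \<bullet> x = r} = {}")
    case False
    let ?P = "P \<inter> {x. c \<bullet> x = r}"
    have "nat (aff_dim ?P + 1) < nat (aff_dim P + 1)"
      using aff_dim_Int_hyperplane_less[OF False that] aff_dim_geq[of ?P] by simp
    moreover have "polyhedron ?P"
      using less.prems polyhedron_hyperplane by blast
    ultimately obtain V where V: "finite V" "V \<subseteq> ?P" "?P \<subseteq> convex hull V + recession ?P"
      using less.hyps[of ?P] by auto
    obtain x where x: "x \<in> ?P" using False by auto
    \<comment> \<open>\<open>recession\<close> quantifies over all base points, so this is no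
      instance of monotonicity; one ray inside the slice suffices since \<open>P\<close> is a
      polyhedron.\<close>
    have "recession ?P \<subseteq> recession P"
    proof
      fix d assume "d \<in> recession ?P"
      then have "x + real k *\<^sub>R d \<in> P" for k :: nat
        using recessionD_scaleR[of d ?P x "real k"] x by simp
      with x show "d \<in> recession P" by (intro polyhedron_recessionI[OF less.prems, of x]) simp_all
    qed
    then show ?thesis
      using V(1,2) order_trans[OF V(3) set_plus_mono2[OF order_refl]] by auto
  qed (auto intro: exI[of _ "{}"])
  show ?case
  proof (cases "bounded P \<or> P = {}")
    case True
    then have "polytope P" using less.prems polytope_eq_bounded_polyhedron by auto
    then obtain V where "finite V" "P = convex hull V" unfolding polytope_def by auto
    moreover have "0 \<in> recession P" by (simp add: recI)
    ultimately show ?thesis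
      by (metis hull_subset set_zero_plus2 add.commute)
  next
    case False
    then obtain x0 where x0: "x0 \<in> P" by blast
    obtain d where d: "d \<noteq> 0" "\<And>i. i \<in> F \<Longrightarrow> a i \<bullet> d \<le> 0"
      using unbounded_polyhedron_recession[OF P] False by blast
    have dP: "d \<in> recession P" using d recI by blast
    define J where "J = {i\<in>F. a i \<bullet> d < 0}"
    show ?thesis
    proof (cases "J = {}")
      case True
      then have d0: "a i \<bullet> d = 0" if "i \<in> F" for i
        using d that by (force simp: J_def)
      then have md: "- d \<in> recession P" by (intro recI) simp
      \<comment> \<open>Every constraint is constant along \<open>d\<close>, so \<open>P\<close> is
        a union of lines and it is enough to treat the hyperplane orthogonal to
        \<open>d\<close>.\<close>
      have "\<not> P \<subseteq> {x. d \<bullet> x = 0}"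
      proof
        assume "P \<subseteq> {x. d \<bullet> x = 0}"
        moreover have "x0 + d \<in> P" using recessionD[OF dP x0] .
        ultimately have "d \<bullet> x0 = 0" "d \<bullet> (x0 + d) = 0" using x0 by (simp_all add: subset_eq)
        then have "d \<bullet> d = 0" by (simp add: inner_right_distrib)
        with d show False by simp
      qed
      from slice[OF this] obtain V
        where V: "finite V" "V \<subseteq> P" "P \<inter> {x. d \<bullet> x = 0} \<subseteq> convex hull V + recession P" by blast
      have "P \<subseteq> convex hull V + recession P"
      proof
        fix x assume "x \<in> P"
        define s where "s = (d \<bullet> x) / (d \<bullet> d)"
        have "x - s *\<^sub>R d \<in> P"
          using \<open>x \<in> P\<close> d0 by (simp add: P inner_diff_right)
        moreover have "d \<bullet> (x - s *\<^sub>R d) = 0"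
          using d by (simp add: inner_diff_right s_def)
        ultimately obtain v c where "v \<in> convex hull V" "c \<in> recession P" "x - s *\<^sub>R d = v + c"
          using V(3) by (auto elim!: set_plus_elim)
        moreover have "s *\<^sub>R d \<in> recession P"
          by (rule recI) (simp add: d0)
        ultimately show "x \<in> convex hull V + recession P"
          using recession_add[of c P "s *\<^sub>R d"]
          by (metis add.assoc diff_add_cancel set_plus_intro)
      qed
      with V show ?thesis by blast
    next
      case False
      have "\<not> P \<subseteq> {x. a i \<bullet> x = b i}" if "i \<in> J" for i
      proof
        assume "P \<subseteq> {x. a i \<bullet> x = b i}"
        then have "a i \<bullet> x0 = b i" "a i \<bullet> (x0 + d) = b i"
          using x0 recessionD[OF dP x0] by (simp_all add: subset_eq)
        then have "a i \<bullet> d = 0" by (simp add: inner_right_distrib)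
        with that show False by (simp add: J_def)
      qed
      then have "\<forall>i\<in>J. \<exists>V. finite V \<and> V \<subseteq> P \<and> P \<inter> {x. a i \<bullet> x = b i} \<subseteq> convex hull V + recession P"
        using slice by blast
      then obtain V where V: "\<And>i. i \<in> J \<Longrightarrow> finite (V i)" "\<And>i. i \<in> J \<Longrightarrow> V i \<subseteq> P"
        "\<And>i. i \<in> J \<Longrightarrow> P \<inter> {x. a i \<bullet> x = b i} \<subseteq> convex hull V i + recession P" by metis
      have finJ: "finite J" using F by (simp add: J_def)
      let ?V = "\<Union>i\<in>J. V i"
      have "P \<subseteq> convex hull ?V + recession P"
      proof
        fix x assume x: "x \<in> P"
        \<comment> \<open>Going backwards along \<open>d\<close>, constraint \<open>i\<close>
          becomes tight at time \<open>t i\<close>; at the first such time the point lies in a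
          slice, and \<open>m *\<^sub>R d\<close> is given back as a recession vector.\<close>
        define t where "t i = (b i - a i \<bullet> x) / (- (a i \<bullet> d))" for i
        define m where "m = Min (t ` J)"
        have "m \<in> t ` J" using Min_in[of "t ` J"] finJ False unfolding m_def by simp
        then obtain i where i: "i \<in> J" "m = t i" by blast
        have le: "m \<le> t j" if "j \<in> J" for j
          using that finJ by (simp add: m_def)
        have "m \<ge> 0" using i x by (auto simp: t_def J_def P intro!: divide_nonneg_neg)
        have "a j \<bullet> (x - m *\<^sub>R d) \<le> b j" if "j \<in> F" for j
        proof (cases "j \<in> J")
          case True
          with le[OF True] show ?thesis
            by (simp add: t_def J_def inner_diff_right field_simps)
        next
          case False
          with that d have "a j \<bullet> d = 0" by (force simp: J_def)
          with that x show ?thesis by (simp add: P inner_diff_right)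
        qed
        moreover have "a i \<bullet> (x - m *\<^sub>R d) = b i"
          using i by (simp add: t_def J_def inner_diff_right field_simps)
        ultimately have "x - m *\<^sub>R d \<in> P \<inter> {x. a i \<bullet> x = b i}" by (simp add: P)
        then obtain v c where vc: "v \<in> convex hull V i" "c \<in> recession P" "x - m *\<^sub>R d = v + c"
          using V(3)[OF i(1)] by (auto elim!: set_plus_elim)
        have "v \<in> convex hull ?V" using vc(1) i(1) hull_mono[of "V i" ?V] by blast
        moreover have "c + m *\<^sub>R d \<in> recession P"
          using vc(2) dP \<open>m \<ge> 0\<close> recession_add recession_scaleR by blast
        ultimately show "x \<in> convex hull ?V + recession P"
          using vc(3) by (metis add.assoc diff_add_cancel set_plus_intro)
      qed
      then show ?thesis using V finJ by (intro exI[of _ ?V]) auto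
    qed
  qed
qed

section \<open>Convex hulls of sets of integer points\<close>

lemma real_vec_nth [simp]: "real_vec x $ i = real_of_int (x $ i)"
  by (simp add: real_vec_def)

lemma real_vec_0 [simp]: "real_vec 0 = 0"
  and real_vec_add: "real_vec (x + y) = real_vec x + real_vec y"
  by (simp_all add: vec_eq_iff)

lemma inj_real_vec: "inj real_vec"
  by (simp add: inj_on_def vec_eq_iff)

definition int_box :: "int \<Rightarrow> (int ^ 'n) set" where
  "int_box b = {x. \<forall>i. \<bar>x $ i\<bar> \<le> b}"

lemma finite_vec_bounds: "finite {x :: int ^ 'n. \<forall>i. l $ i \<le> x $ i \<and> x $ i \<le> u $ i}"
proof (rule finite_imageD)
  show "inj_on vec_nth {x :: int ^ 'n. \<forall>i. l $ i \<le> x $ i \<and> x $ i \<le> u $ i}"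
    by (simp add: inj_on_def vec_nth_inject)
  have "vec_nth ` {x :: int ^ 'n. \<forall>i. l $ i \<le> x $ i \<and> x $ i \<le> u $ i} \<subseteq> (\<Pi>\<^sub>E i\<in>UNIV. {l $ i..u $ i})"
    by auto
  then show "finite (vec_nth ` {x :: int ^ 'n. \<forall>i. l $ i \<le> x $ i \<and> x $ i \<le> u $ i})"
    by (rule finite_subset) (simp add: finite_PiE)
qed

lemma finite_int_box: "finite (int_box b :: (int ^ 'n) set)"
  using finite_vec_bounds[of "\<chi> i. - b" "\<chi> i. b"]
  by (rule finite_subset[rotated]) (auto simp: int_box_def abs_le_iff minus_le_iff)

lemma finite_subset_int_box:
  fixes F :: "(int ^ 'n) set"
  assumes "finite F"
  obtains b where "F \<subseteq> int_box b"
proof -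
  have "\<bar>x $ i\<bar> \<le> (\<Sum>x\<in>F. \<Sum>i\<in>UNIV. \<bar>x $ i\<bar>)" if "x \<in> F" for x i
  proof -
    have "\<bar>x $ i\<bar> \<le> (\<Sum>i\<in>UNIV. \<bar>x $ i\<bar>)" by (rule member_le_sum) simp_all
    also have "\<dots> \<le> (\<Sum>x\<in>F. \<Sum>i\<in>UNIV. \<bar>x $ i\<bar>)"
      using that assms by (intro member_le_sum[of x F "\<lambda>x. \<Sum>i\<in>UNIV. \<bar>x $ i\<bar>"]) (simp_all add: sum_nonneg)
    finally show ?thesis .
  qed
  then show thesis by (intro that) (auto simp: int_box_def)
qed

lemma bounded_hull_finite: "finite F \<Longrightarrow> bounded (convex hull F :: 'a::euclidean_space set)"
  by (simp add: finite_imp_bounded bounded_convex_hull)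

text \<open>Addition alone gives natural multiples; a real multiple of \<open>r\<close> lies on the
  segment from 0 to a larger natural multiple. Sums are doubled midpoints.\<close>

lemma convex_cone_hull_int_monoid:
  fixes R :: "(int ^ 'n) set"
  assumes "0 \<in> R" and add: "\<And>x y. x \<in> R \<Longrightarrow> y \<in> R \<Longrightarrow> x + y \<in> R"
  shows "convex_cone (convex hull (real_vec ` R))"
proof -
  let ?C = "convex hull (real_vec ` R)"
  have 0: "0 \<in> ?C"
    using assms(1) by (metis hull_inc imageI real_vec_0)
  have mult: "real k *\<^sub>R real_vec r \<in> real_vec ` R" if "r \<in> R" for r k
  proof (induction k)
    case 0
    then show ?case using assms(1) by (metis image_eqI of_nat_0 real_vec_0 scaleR_zero_left)
  next
    case (Suc k)
    then obtain s where s: "s \<in> R" "real k *\<^sub>R real_vec r = real_vec s" by blast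
    have "real (Suc k) *\<^sub>R real_vec r = real_vec (s + r)"
      using s(2) by (simp add: real_vec_add scaleR_add_left)
    then show ?case using add[OF s(1) that] by simp
  qed
  have scale: "t *\<^sub>R x \<in> ?C" if "x \<in> ?C" "t \<ge> 0" for x t
  proof -
    obtain k :: nat where k: "t < real k" using reals_Archimedean2 by blast
    have "(\<lambda>x. t *\<^sub>R x) ` real_vec ` R \<subseteq> ?C"
    proof clarify
      fix r assume "r \<in> R"
      have "(1 - t / real k) *\<^sub>R 0 + (t / real k) *\<^sub>R (real k *\<^sub>R real_vec r) \<in> ?C"
        using k \<open>t \<ge> 0\<close> mult[OF \<open>r \<in> R\<close>, of k] 0
        by (intro convexD[OF convex_convex_hull]) (simp_all add: hull_inc)
      with k \<open>t \<ge> 0\<close> show "t *\<^sub>R real_vec r \<in> ?C" by simp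
    qed
    then have "convex hull ((\<lambda>x. t *\<^sub>R x) ` real_vec ` R) \<subseteq> ?C"
      by (simp add: subset_hull)
    with \<open>x \<in> ?C\<close> show ?thesis by (auto simp: convex_hull_scaling)
  qed
  moreover have "x + y \<in> ?C" if "x \<in> ?C" "y \<in> ?C" for x y
  proof -
    have "(1/2) *\<^sub>R x + (1/2) *\<^sub>R y \<in> ?C"
      using that by (intro convexD[OF convex_convex_hull]) simp_all
    from scale[OF this, of 2] show ?thesis by (simp add: scaleR_add_right)
  qed
  ultimately show ?thesis using 0 by (simp add: convex_cone_iff)
qed

lemma hull_decomposition:
  fixes S :: "(int ^ 'n) set"
  assumes poly: "polyhedron (convex hull (real_vec ` S))" and "S \<noteq> {}"
  obtains b where "S \<inter> int_box b \<noteq> {}"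
    "convex hull (real_vec ` S) =
       {q + c | q c. q \<in> convex hull (real_vec ` (S \<inter> int_box b)) \<and> c \<in> recession (convex hull (real_vec ` S))}"
proof -
  let ?P = "convex hull (real_vec ` S)"
  obtain V where V: "finite V" "V \<subseteq> ?P" "?P \<subseteq> convex hull V + recession ?P"
    using polyhedron_subset_hull_plus_recession[OF poly] by blast
  have "\<exists>F. finite F \<and> F \<subseteq> real_vec ` S \<and> v \<in> convex hull F" if "v \<in> V" for v
  proof -
    have "v \<in> ?P" using that V by blast
    then obtain F u where "finite F" "F \<subseteq> real_vec ` S" "\<forall>x\<in>F. 0 \<le> u x" "sum u F = 1" "(\<Sum>v\<in>F. u v *\<^sub>R v) = v"
      unfolding convex_hull_explicit by blast
    then show ?thesis by (intro exI[of _ F]) (auto simp: convex_hull_finite)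
  qed
  then obtain F where F: "\<And>v. v \<in> V \<Longrightarrow> finite (F v)" "\<And>v. v \<in> V \<Longrightarrow> F v \<subseteq> real_vec ` S"
    "\<And>v. v \<in> V \<Longrightarrow> v \<in> convex hull F v" by metis
  obtain x0 where x0: "x0 \<in> S" using \<open>S \<noteq> {}\<close> by blast
  have "finite (\<Union>v\<in>V. F v)" "(\<Union>v\<in>V. F v) \<subseteq> real_vec ` S"
    using F(1,2) V(1) by auto
  from finite_subset_image[OF this] obtain G
    where G: "G \<subseteq> S" "finite G" "(\<Union>v\<in>V. F v) = real_vec ` G" by blast
  obtain b where b: "insert x0 G \<subseteq> int_box b"
    using finite_subset_int_box[of "insert x0 G"] G by blast
  let ?Q = "convex hull (real_vec ` (S \<inter> int_box b))"
  have "v \<in> ?Q" if "v \<in> V" for v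
  proof -
    have "F v \<subseteq> real_vec ` (S \<inter> int_box b)" using that G b by blast
    with F(3)[OF that] show ?thesis using hull_mono by blast
  qed
  then have "convex hull V \<subseteq> ?Q" by (simp add: subset_hull subsetI)
  moreover have "?Q \<subseteq> ?P" by (intro hull_mono) blast
  ultimately have "?P = {q + c | q c. q \<in> ?Q \<and> c \<in> recession ?P}"
    using V(3) recessionD[of _ ?P] unfolding set_plus_def by blast
  moreover have "S \<inter> int_box b \<noteq> {}" using x0 b by blast
  ultimately show thesis using that by blast
qed

lemma decomposition_of_class:
  fixes S :: "(int ^ 'n) set"
  assumes "P = convex hull (real_vec ` S)" "polyhedron P" "S \<noteq> {}"
    and R: "recession P = convex hull (real_vec ` R)" "A R"
    and A: "\<And>b. S \<inter> int_box b \<noteq> {} \<Longrightarrow> A (S \<inter> int_box b)"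
  shows "\<exists>Q C. convex_polyhedron_of A Q \<and> bounded Q \<and> convex_cone_of A C \<and> P = {q + c | q c. q \<in> Q \<and> c \<in> C}"
proof -
  obtain b where b: "S \<inter> int_box b \<noteq> {}"
    "P = {q + c | q c. q \<in> convex hull (real_vec ` (S \<inter> int_box b)) \<and> c \<in> recession P}"
    using hull_decomposition[of S] assms(1-3) by blast
  have "cone (recession P)"
    using convex_cone_recession[of P] by (simp add: convex_cone_iff cone_def)
  then have "convex_cone_of A (recession P)"
    using R by (auto simp: convex_cone_of_def convex_polyhedron_of_def)
  moreover have "convex_polyhedron_of A (convex hull (real_vec ` (S \<inter> int_box b)))"
    using A[OF b(1)] by (auto simp: convex_polyhedron_of_def)
  moreover have "bounded (convex hull (real_vec ` (S \<inter> int_box b)))"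
    by (simp add: bounded_hull_finite finite_int_box)
  ultimately show ?thesis using b(2) by blast
qed

section \<open>Decomposition of a vector into its level sets\<close>

text \<open>A vector with entries in [0, 1] is a convex combination of 0 and the indicators of its
  level sets. The induction on the support peels off the lowest layer, whose height is the least
  nonzero entry.\<close>

lemma mem_convex_by_level_sets:
  fixes v :: "real ^ 'n"
  assumes "convex K" "0 \<in> K" "\<And>i. 0 \<le> v $ i" "\<And>i. v $ i \<le> 1"
    and "\<And>t. 0 \<le> t \<Longrightarrow> t < 1 \<Longrightarrow> (\<chi> i. if v $ i > t then 1 else 0) \<in> K"
  shows "v \<in> K"
  using assms(3-)
proof (induction "card {i. v $ i \<noteq> 0}" arbitrary: v rule: less_induct)
  case less
  show ?case
  proof (cases "{i. v $ i \<noteq> 0} = {}")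
    case True
    then have "v = 0" by (auto simp: vec_eq_iff)
    with assms(2) show ?thesis by simp
  next
    case False
    define m where "m = Min (vec_nth v ` {i. v $ i \<noteq> 0})"
    have "m \<in> vec_nth v ` {i. v $ i \<noteq> 0}"
      unfolding m_def using False by (intro Min_in) simp_all
    then obtain i0 where i0: "v $ i0 \<noteq> 0" "m = v $ i0" by blast
    have m_le: "m \<le> v $ i" if "v $ i \<noteq> 0" for i
      unfolding m_def using that by (intro Min_le) simp_all
    have m: "0 < m" "m \<le> 1"
      using i0 less.prems(1,2)[of i0] by simp_all
    have zero: "v $ i = 0" if "\<not> v $ i > 0" for i
      using that less.prems(1)[of i] by simp
    let ?e = "(\<chi> i. if v $ i > 0 then 1 else 0) :: real ^ 'n"
    have e: "?e \<in> K" using less.prems(3)[of 0] by simp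
    show ?thesis
    proof (cases "m = 1")
      case True
      have "v $ i = 1" if "v $ i > 0" for i
        using m_le[of i] less.prems(2)[of i] that True by simp
      then have "v = ?e" using zero by (simp add: vec_eq_iff)
      with e show ?thesis by simp
    next
      case False
      with m have m1: "m < 1" by simp
      \<comment> \<open>\<open>w\<close> is \<open>v\<close> without its lowest layer, rescaled by
        the remaining height. Its level set at \<open>t\<close> is that of \<open>v\<close> at
        \<open>t * (1 - m) + m\<close>, and \<open>i0\<close> has left its support.\<close>
      define w where "w = (1 / (1 - m)) *\<^sub>R (v - m *\<^sub>R ?e)"
      have w: "w $ i = (if v $ i > 0 then (v $ i - m) / (1 - m) else 0)" for i
        using zero[of i] by (simp add: w_def)
      have "w \<in> K"
      proof (rule less.hyps)
        have "{i. w $ i \<noteq> 0} \<subseteq> {i. v $ i \<noteq> 0} - {i0}"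
          using i0 by (auto simp: w)
        then show "card {i. w $ i \<noteq> 0} < card {i. v $ i \<noteq> 0}"
          using i0 by (intro psubset_card_mono) auto
        show "0 \<le> w $ i" for i using m_le[of i] m1 by (simp add: w)
        show "w $ i \<le> 1" for i using less.prems(2)[of i] m1 by (simp add: w)
        fix t :: real assume t: "0 \<le> t" "t < 1"
        have "t * (1 - m) < 1 * (1 - m)" using t m1 by (intro mult_strict_right_mono) simp_all
        moreover have "0 \<le> t * (1 - m)" using t m1 by simp
        ultimately have "(\<chi> i. if v $ i > t * (1 - m) + m then 1 else 0) \<in> K"
          using m by (intro less.prems(3)) simp_all
        moreover have "w $ i > t \<longleftrightarrow> v $ i > t * (1 - m) + m" for i
        proof (cases "v $ i > 0")
          case True
          have "t < (v $ i - m) / (1 - m) \<longleftrightarrow> t * (1 - m) < v $ i - m"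
            using m1 by (intro pos_less_divide_eq) simp
          with True show ?thesis by (simp add: w less_diff_eq)
        next
          case False
          with m(1) t \<open>0 \<le> t * (1 - m)\<close> show ?thesis unfolding w by argo
        qed
        ultimately show "(\<chi> i. if w $ i > t then 1 else 0) \<in> K" by simp
      qed
      then have "m *\<^sub>R ?e + (1 - m) *\<^sub>R w \<in> K"
        using e m by (intro convexD[OF assms(1)]) simp_all
      also have "m *\<^sub>R ?e + (1 - m) *\<^sub>R w = v"
        using m1 by (simp add: w_def)
      finally show ?thesis .
    qed
  qed
qed

lemma mem_convex_cone_by_level_sets:
  fixes v :: "real ^ 'n"
  assumes "convex_cone K" "\<And>i. 0 \<le> v $ i"
    and "\<And>t. 0 \<le> t \<Longrightarrow> (\<chi> i. if v $ i > t then 1 else 0) \<in> K"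
  shows "v \<in> K"
proof -
  \<comment> \<open>The sum dominates every entry, and the 1 keeps \<open>M\<close> positive when
    \<open>v\<close> is 0.\<close>
  define M where "M = 1 + (\<Sum>i\<in>UNIV. v $ i)"
  have le: "v $ i \<le> M" for i
    using member_le_sum[of i UNIV "vec_nth v"] assms(2) by (simp add: M_def)
  have M: "M > 0" using assms(2) by (simp add: M_def sum_nonneg add_pos_nonneg)
  have "(1 / M) *\<^sub>R v \<in> K"
  proof (rule mem_convex_by_level_sets)
    show "convex K" "0 \<in> K" using assms(1) by (simp_all add: convex_cone_def convex_cone_contains_0)
    show "0 \<le> ((1 / M) *\<^sub>R v) $ i" "((1 / M) *\<^sub>R v) $ i \<le> 1" for i
      using M assms(2) le[of i] by simp_all
    fix t :: real assume "0 \<le> t"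
    have "((1 / M) *\<^sub>R v) $ i > t \<longleftrightarrow> v $ i > t * M" for i
      using M by (simp add: pos_less_divide_eq)
    then show "(\<chi> i. if ((1 / M) *\<^sub>R v) $ i > t then 1 else 0) \<in> K"
      using assms(3)[of "t * M"] M \<open>0 \<le> t\<close> by simp
  qed
  from convex_cone_scaleR[OF assms(1) _ this, of M] M show ?thesis by simp
qed

section \<open>L-natural-convex sets\<close>

lemma ceil_mid_nth: "ceil_mid p q $ i = - (- (p $ i + q $ i) div 2)"
  using ceiling_divide_eq_div[of "p $ i + q $ i" 2] by (simp add: ceil_mid_def)

lemma floor_mid_nth: "floor_mid p q $ i = (p $ i + q $ i) div 2"
  using floor_divide_of_int_eq[of "p $ i + q $ i" 2, where ?'a = real] by (simp add: floor_mid_def)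

lemma Lnat_convexD:
  assumes "Lnat_convex T" "p \<in> T" "q \<in> T"
  shows "ceil_mid p q \<in> T" "floor_mid p q \<in> T"
  using assms by (auto simp: Lnat_convex_def)

text \<open>Negation exchanges the two rounded midpoints; it transfers statements about maxima to
  minima and back.\<close>

lemma Lnat_convex_uminus:
  assumes "Lnat_convex T"
  shows "Lnat_convex (uminus ` T)"
proof -
  have "ceil_mid (- p) (- q) = - floor_mid p q" "floor_mid (- p) (- q) = - ceil_mid p q" for p q :: "int ^ 'a"
    by (simp_all add: vec_eq_iff ceil_mid_nth floor_mid_nth algebra_simps)
  then show ?thesis using assms by (auto simp: Lnat_convex_def)
qed

lemma Lnat_convex_Int_int_box:
  assumes "Lnat_convex T" "T \<inter> int_box b \<noteq> {}"
  shows "Lnat_convex (T \<inter> int_box b)"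
proof -
  have "\<bar>(x + y) div 2\<bar> \<le> b \<and> \<bar>- (- (x + y) div 2)\<bar> \<le> b" if "\<bar>x\<bar> \<le> b" "\<bar>y\<bar> \<le> b" for x y :: int
    using that by linarith
  then have "ceil_mid p q \<in> int_box b \<and> floor_mid p q \<in> int_box b"
    if "p \<in> int_box b" "q \<in> int_box b" for p q :: "int ^ 'a"
    using that unfolding int_box_def ceil_mid_nth floor_mid_nth mem_Collect_eq by blast
  then show ?thesis using assms by (auto simp: Lnat_convex_def)
qed

text \<open>Iterating \<open>q \<mapsto> \<lceil>(p + q) / 2\<rceil>\<close> drives each coordinate of \<open>q - p\<close> to \<open>1\<close> if it is positive
  and to \<open>0\<close> otherwise.\<close>

lemma Lnat_step_up:
  assumes T: "Lnat_convex T" and "p \<in> T" "q \<in> T"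
  shows "(\<chi> i. if q $ i > p $ i then p $ i + 1 else p $ i) \<in> T"
  using \<open>q \<in> T\<close>
proof (induction "nat (\<Sum>i\<in>UNIV. \<bar>q $ i - p $ i\<bar>)" arbitrary: q rule: less_induct)
  case less
  let ?q = "ceil_mid p q"
  show ?case
  \<comment> \<open>The differences 0 and 1 are exactly the fixed points of the halving step; any
    other one, including -1, which is rounded up to 0, shrinks in absolute value.\<close>
  proof (cases "\<forall>i. q $ i - p $ i \<in> {0, 1}")
    case True
    then have "q $ i = p $ i \<or> q $ i = p $ i + 1" for i
      by (metis add.commute diff_add_cancel empty_iff eq_iff_diff_eq_0 insert_iff)
    then have "(if q $ i > p $ i then p $ i + 1 else p $ i) = q $ i" for i
      by (metis less_irrefl less_add_one)
    then have "(\<chi> i. if q $ i > p $ i then p $ i + 1 else p $ i) = q"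
      by (simp add: vec_eq_iff)
    with less.prems show ?thesis by simp
  next
    case False
    then obtain k where k: "q $ k - p $ k \<noteq> 0" "q $ k - p $ k \<noteq> 1" by auto
    have "(\<Sum>i\<in>UNIV. \<bar>?q $ i - p $ i\<bar>) < (\<Sum>i\<in>UNIV. \<bar>q $ i - p $ i\<bar>)"
    proof (rule sum_strict_mono_ex1)
      have "\<bar>- (- (x + y) div 2) - x\<bar> \<le> \<bar>y - x\<bar>" for x y :: int by linarith
      then show "\<forall>i\<in>UNIV. \<bar>?q $ i - p $ i\<bar> \<le> \<bar>q $ i - p $ i\<bar>" by (simp add: ceil_mid_nth)
      have "\<bar>?q $ k - p $ k\<bar> < \<bar>q $ k - p $ k\<bar>"
        unfolding ceil_mid_nth using k by linarith
      then show "\<exists>i\<in>UNIV. \<bar>?q $ i - p $ i\<bar> < \<bar>q $ i - p $ i\<bar>" by blast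
    qed simp
    moreover have "0 \<le> (\<Sum>i\<in>UNIV. \<bar>?q $ i - p $ i\<bar>)" by (simp add: sum_nonneg)
    ultimately have "nat (\<Sum>i\<in>UNIV. \<bar>?q $ i - p $ i\<bar>) < nat (\<Sum>i\<in>UNIV. \<bar>q $ i - p $ i\<bar>)"
      by linarith
    then have "(\<chi> i. if ?q $ i > p $ i then p $ i + 1 else p $ i) \<in> T"
      using Lnat_convexD(1)[OF T \<open>p \<in> T\<close> less.prems] by (rule less.hyps)
    moreover have "?q $ i > p $ i \<longleftrightarrow> q $ i > p $ i" for i
      unfolding ceil_mid_nth by linarith
    ultimately show ?thesis by simp
  qed
qed

text \<open>Unit steps are repeated with the target \<open>q\<close> fixed. A large \<open>k\<close>
  yields the componentwise maximum, a prescribed one the truncated shift in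
  \<open>Lnat_min_shift\<close>.\<close>

lemma Lnat_move_up:
  assumes T: "Lnat_convex T" and "p \<in> T" "q \<in> T"
  shows "(\<chi> i. max (p $ i) (min (p $ i + int k) (q $ i))) \<in> T"
proof (induction k)
  case 0
  have "(\<chi> i. max (p $ i) (min (p $ i + int 0) (q $ i))) = p"
    by (simp add: vec_eq_iff)
  with \<open>p \<in> T\<close> show ?case by simp
next
  case (Suc k)
  let ?r = "\<chi> i. max (p $ i) (min (p $ i + int k) (q $ i))"
  have "(\<chi> i. if q $ i > ?r $ i then ?r $ i + 1 else ?r $ i) \<in> T"
    using Lnat_step_up[OF T Suc \<open>q \<in> T\<close>] .
  also have "(\<chi> i. if q $ i > ?r $ i then ?r $ i + 1 else ?r $ i) = (\<chi> i. max (p $ i) (min (p $ i + int (Suc k)) (q $ i)))"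
    by (simp add: vec_eq_iff) linarith
  finally show ?case .
qed

lemma Lnat_max:
  assumes T: "Lnat_convex T" and "p \<in> T" "q \<in> T"
  shows "(\<chi> i. max (p $ i) (q $ i)) \<in> T"
proof -
  define k where "k = nat (\<Sum>i\<in>UNIV. \<bar>q $ i - p $ i\<bar>)"
  have "\<bar>q $ i - p $ i\<bar> \<le> int k" for i
    using member_le_sum[of i UNIV "\<lambda>i. \<bar>q $ i - p $ i\<bar>"] by (simp add: k_def sum_nonneg)
  then have "q $ i \<le> p $ i + int k" for i
    by (smt (verit))
  then have "(\<chi> i. max (p $ i) (q $ i)) = (\<chi> i. max (p $ i) (min (p $ i + int k) (q $ i)))"
    by (simp add: vec_eq_iff min_absorb2)
  then show ?thesis using Lnat_move_up[OF assms] by simp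
qed

lemma Lnat_min:
  assumes T: "Lnat_convex T" and "p \<in> T" "q \<in> T"
  shows "(\<chi> i. min (p $ i) (q $ i)) \<in> T"
proof -
  have "(\<chi> i. max ((- p) $ i) ((- q) $ i)) \<in> uminus ` T"
    using assms by (intro Lnat_max Lnat_convex_uminus) simp_all
  also have "(\<chi> i. max ((- p) $ i) ((- q) $ i)) = - (\<chi> i. min (p $ i) (q $ i))"
    by (simp add: vec_eq_iff minus_min_eq_max)
  finally show ?thesis by auto
qed

text \<open>Translation submodularity: start at the componentwise minimum of \<open>p\<close> and
  \<open>q\<close> and move up \<open>a\<close> units towards \<open>q\<close>.\<close>

lemma Lnat_min_shift:
  assumes T: "Lnat_convex T" and "p \<in> T" "q \<in> T" "a \<ge> 0"
  shows "(\<chi> i. min (p $ i + a) (q $ i)) \<in> T"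
proof -
  let ?r = "\<chi> i. min (p $ i) (q $ i)"
  have "(\<chi> i. max (?r $ i) (min (?r $ i + int (nat a)) (q $ i))) \<in> T"
    by (rule Lnat_move_up[OF T Lnat_min[OF T assms(2,3)] assms(3)])
  also have "(\<chi> i. max (?r $ i) (min (?r $ i + int (nat a)) (q $ i))) = (\<chi> i. min (p $ i + a) (q $ i))"
    using \<open>a \<ge> 0\<close> by (simp add: vec_eq_iff) linarith
  finally show ?thesis .
qed

lemma Lnat_max_shift:
  assumes T: "Lnat_convex T" and "p \<in> T" "q \<in> T" "a \<ge> 0"
  shows "(\<chi> i. max (p $ i - a) (q $ i)) \<in> T"
proof -
  have "(\<chi> i. min ((- p) $ i + a) ((- q) $ i)) \<in> uminus ` T"
    using assms by (intro Lnat_min_shift Lnat_convex_uminus) simp_all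
  also have "(\<chi> i. min ((- p) $ i + a) ((- q) $ i)) = - (\<chi> i. max (p $ i - a) (q $ i))"
    by (simp add: vec_eq_iff minus_max_eq_min)
  finally show ?thesis by auto
qed

text \<open>Adding a coordinate \<open>None\<close> and all translates along the all-one vector turns the bounds
  \<open>p $ i \<le> c\<close>, \<open>p $ i \<ge> c\<close> and \<open>p $ i - p $ j \<le> c\<close> into bounds on differences of two coordinates.\<close>

definition diag_lift :: "(int ^ 'n) set \<Rightarrow> ('n option \<Rightarrow> int) set" where
  "diag_lift T = {f. (\<chi> i. f (Some i) - f None) \<in> T}"

lemma diag_lift_shift: "f \<in> diag_lift T \<Longrightarrow> (\<lambda>i. f i + c) \<in> diag_lift T"
  by (simp add: diag_lift_def)

text \<open>With maxima and shifts this makes the lift an L-convex set in one dimension more.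
  Normalising \<open>None\<close> to 0 translates the two points relative to each other by
  \<open>g None - f None\<close>, so the translated minimum applies.\<close>

lemma diag_lift_min:
  assumes T: "Lnat_convex T" and "f \<in> diag_lift T" "g \<in> diag_lift T"
  shows "(\<lambda>i. min (f i) (g i)) \<in> diag_lift T"
proof -
  have *: "(\<lambda>i. min (f i) (g i)) \<in> diag_lift T"
    if "f \<in> diag_lift T" "g \<in> diag_lift T" "f None \<le> g None" for f g
  proof -
    let ?p = "\<chi> i. f (Some i) - f None" and ?q = "\<chi> i. g (Some i) - g None"
    have "(\<chi> i. min (?q $ i + (g None - f None)) (?p $ i)) \<in> T"
      using that by (intro Lnat_min_shift[OF T]) (simp_all add: diag_lift_def)
    also have "(\<chi> i. min (?q $ i + (g None - f None)) (?p $ i)) = (\<chi> i. min (f (Some i)) (g (Some i)) - min (f None) (g None))"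
      using that(3) by (simp add: vec_eq_iff) linarith
    finally show ?thesis by (simp add: diag_lift_def)
  qed
  show ?thesis
    using *[of f g] *[of g f] assms(2,3) by (cases "f None \<le> g None") (simp_all add: min.commute)
qed

lemma diag_lift_max:
  assumes T: "Lnat_convex T" and "f \<in> diag_lift T" "g \<in> diag_lift T"
  shows "(\<lambda>i. max (f i) (g i)) \<in> diag_lift T"
proof -
  have *: "(\<lambda>i. max (f i) (g i)) \<in> diag_lift T"
    if "f \<in> diag_lift T" "g \<in> diag_lift T" "f None \<le> g None" for f g
  proof -
    let ?p = "\<chi> i. f (Some i) - f None" and ?q = "\<chi> i. g (Some i) - g None"
    have "(\<chi> i. max (?p $ i - (g None - f None)) (?q $ i)) \<in> T"
      using that by (intro Lnat_max_shift[OF T]) (simp_all add: diag_lift_def)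
    also have "(\<chi> i. max (?p $ i - (g None - f None)) (?q $ i)) = (\<chi> i. max (f (Some i)) (g (Some i)) - max (f None) (g None))"
      using that(3) by (simp add: vec_eq_iff) linarith
    finally show ?thesis by (simp add: diag_lift_def)
  qed
  show ?thesis
    using *[of f g] *[of g f] assms(2,3) by (cases "f None \<le> g None") (simp_all add: max.commute)
qed

text \<open>Witnesses for single pairs are glued. Shifted to agree with \<open>p\<close> at
  \<open>i\<close>, the witness for \<open>(i, j)\<close> is at most \<open>p j\<close> at
  \<open>j\<close>; the minimum over \<open>j\<close> touches \<open>p\<close> at \<open>i\<close>
  and stays below it, and the maximum over \<open>i\<close> is \<open>p\<close>. Hence difference
  bounds determine the set.\<close>

lemma diag_lift_memI:
  fixes T :: "(int ^ 'n) set"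
  assumes T: "Lnat_convex T" and p: "\<And>i j. \<exists>f\<in>diag_lift T. p i - p j \<le> f i - f j"
  shows "p \<in> diag_lift T"
proof -
  have below: "\<exists>f\<in>diag_lift T. f i = p i \<and> (\<forall>j\<in>J. f j \<le> p j)" for i and J :: "'n option set"
  proof -
    have "finite J" by simp
    then show ?thesis
    proof (induction J)
      case empty
      obtain f where "f \<in> diag_lift T" using p by blast
      then show ?case using diag_lift_shift[of f T "p i - f i"] by (intro bexI[of _ "\<lambda>j. f j + (p i - f i)"]) simp_all
    next
      case (insert j J)
      then obtain g where g: "g \<in> diag_lift T" "g i = p i" "\<forall>j\<in>J. g j \<le> p j" by blast
      obtain f where f: "f \<in> diag_lift T" "p i - p j \<le> f i - f j" using p by blast
      let ?f = "\<lambda>k. f k + (p i - f i)"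
      have "(\<lambda>k. min (g k) (?f k)) \<in> diag_lift T"
        using diag_lift_min[OF T g(1) diag_lift_shift[OF f(1)]] .
      then show ?case using f(2) g(2,3) by (intro bexI[of _ "\<lambda>k. min (g k) (?f k)"]) (auto simp: min_le_iff_disj)
    qed
  qed
  have "\<exists>f\<in>diag_lift T. (\<forall>j. f j \<le> p j) \<and> (\<forall>i\<in>I. f i = p i)" if "I \<noteq> {}" for I :: "'n option set"
  proof -
    have "finite I" by simp
    then show ?thesis
      using that
    proof (induction I rule: finite_ne_induct)
      case (singleton i)
      then show ?case using below[of i UNIV] by auto
    next
      case (insert i I)
      then obtain g where g: "g \<in> diag_lift T" "\<forall>j. g j \<le> p j" "\<forall>i\<in>I. g i = p i" by blast
      obtain f where f: "f \<in> diag_lift T" "f i = p i" "\<forall>j. f j \<le> p j" using below[of i UNIV] by auto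
      show ?case
        using diag_lift_max[OF T f(1) g(1)] f g
        by (intro bexI[of _ "\<lambda>k. max (f k) (g k)"]) (auto simp: max_def antisym)
    qed
  qed
  from this[of UNIV] obtain f where "f \<in> diag_lift T" "\<forall>i. f i = p i" by auto
  then show ?thesis by (metis ext)
qed

section \<open>Tight difference bounds, their homogeneous system, and rounding\<close>

text \<open>Sending \<open>None\<close> to 0 makes coordinate bounds and difference bounds instances
  of the one functional \<open>opt_axis i - opt_axis j\<close>.\<close>

definition opt_axis :: "'n option \<Rightarrow> real ^ 'n" where
  "opt_axis k = (case k of None \<Rightarrow> 0 | Some i \<Rightarrow> axis i 1)"

lemma opt_axis_inner [simp]: "opt_axis None \<bullet> z = 0" "opt_axis (Some i) \<bullet> z = z $ i"
  by (simp_all add: opt_axis_def inner_axis')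

definition diff_pairs :: "(int ^ 'n) set \<Rightarrow> ('n option \<times> 'n option) set" where
  "diff_pairs T = {(i, j). \<exists>c. \<forall>f\<in>diag_lift T. f i - f j \<le> c}"

lemma diag_lift_nonempty: "T \<noteq> {} \<Longrightarrow> diag_lift T \<noteq> {}"
proof -
  assume "T \<noteq> {}"
  then obtain t where "t \<in> T" by blast
  then have "case_option 0 (vec_nth t) \<in> diag_lift T" by (simp add: diag_lift_def)
  then show ?thesis by blast
qed

lemma diff_pairs_attained:
  assumes "T \<noteq> {}" "(i, j) \<in> diff_pairs T"
  shows "\<exists>f\<in>diag_lift T. \<forall>g\<in>diag_lift T. g i - g j \<le> f i - f j"
proof -
  obtain c where c: "\<And>f. f \<in> diag_lift T \<Longrightarrow> f i - f j \<le> c"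
    using assms(2) by (auto simp: diff_pairs_def)
  obtain f0 where "f0 \<in> diag_lift T" using diag_lift_nonempty[OF assms(1)] by blast
  from ex_has_least_nat[of "\<lambda>f. f \<in> diag_lift T", OF this, of "\<lambda>f. nat (c - (f i - f j))"]
  obtain f where f: "f \<in> diag_lift T"
    "\<And>g. g \<in> diag_lift T \<Longrightarrow> nat (c - (f i - f j)) \<le> nat (c - (g i - g j))" by blast
  have "g i - g j \<le> f i - f j" if "g \<in> diag_lift T" for g
    using f(2)[OF that] c[OF that] c[OF f(1)] by linarith
  with f(1) show ?thesis by blast
qed

definition Lnat_recession :: "(int ^ 'n) set \<Rightarrow> (int ^ 'n) set" where
  "Lnat_recession T = {r. \<forall>(i, j)\<in>diff_pairs T. case_option 0 (vec_nth r) i \<le> case_option 0 (vec_nth r) j}"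

lemma opt_axis_inner_real_vec: "opt_axis k \<bullet> real_vec r = real_of_int (case_option 0 (vec_nth r) k)"
  by (cases k) simp_all

lemma Lnat_convex_Lnat_recession:
  fixes T :: "(int ^ 'n) set"
  shows "Lnat_convex (Lnat_recession T)"
proof -
  have 1: "case_option 0 (vec_nth (ceil_mid p q)) k =
      - (- (case_option 0 (vec_nth p) k + case_option 0 (vec_nth q) k) div 2)"
    and 2: "case_option 0 (vec_nth (floor_mid p q)) k =
      (case_option 0 (vec_nth p) k + case_option 0 (vec_nth q) k) div 2" for p q :: "int ^ 'n" and k
    by (cases k; simp add: ceil_mid_nth floor_mid_nth)+
  have "a \<le> c \<Longrightarrow> b \<le> d \<Longrightarrow> - (- (a + b) div 2) \<le> - (- (c + d) div 2)"
    and "a \<le> c \<Longrightarrow> b \<le> d \<Longrightarrow> (a + b) div 2 \<le> (c + d) div 2" for a b c d :: int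
    by linarith+
  then have "case_option 0 (vec_nth (ceil_mid p q)) i \<le> case_option 0 (vec_nth (ceil_mid p q)) j \<and>
      case_option 0 (vec_nth (floor_mid p q)) i \<le> case_option 0 (vec_nth (floor_mid p q)) j"
    if "case_option 0 (vec_nth p) i \<le> case_option 0 (vec_nth p) j"
      "case_option 0 (vec_nth q) i \<le> case_option 0 (vec_nth q) j" for p q :: "int ^ 'n" and i j
    using that unfolding 1 2 by blast
  then have "ceil_mid p q \<in> Lnat_recession T \<and> floor_mid p q \<in> Lnat_recession T"
    if "p \<in> Lnat_recession T" "q \<in> Lnat_recession T" for p q
    using that unfolding Lnat_recession_def by blast
  moreover have "0 \<in> Lnat_recession T"
    by (auto simp: Lnat_recession_def split: option.splits)
  ultimately show ?thesis unfolding Lnat_convex_def by blast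
qed

definition Lnat_recession_cone :: "(int ^ 'n) set \<Rightarrow> (real ^ 'n) set" where
  "Lnat_recession_cone T = {d. \<forall>(i, j)\<in>diff_pairs T. opt_axis i \<bullet> d \<le> opt_axis j \<bullet> d}"

lemma real_vec_mem_Lnat_recession_cone:
  "real_vec r \<in> Lnat_recession_cone T \<longleftrightarrow> r \<in> Lnat_recession T"
  by (simp add: Lnat_recession_cone_def Lnat_recession_def opt_axis_inner_real_vec)

lemma convex_cone_Lnat_recession_cone: "convex_cone (Lnat_recession_cone T)"
  by (auto simp: Lnat_recession_cone_def convex_cone_iff inner_right_distrib
      intro!: add_mono mult_left_mono)

lemma convex_cone_hull_Lnat_recession:
  "convex_cone (convex hull (real_vec ` Lnat_recession T))"
proof (rule convex_cone_hull_int_monoid)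
  have "x \<in> Lnat_recession T \<longleftrightarrow> real_vec x \<in> Lnat_recession_cone T" for x
    by (simp add: real_vec_mem_Lnat_recession_cone)
  then show "0 \<in> Lnat_recession T"
    "\<And>x y. x \<in> Lnat_recession T \<Longrightarrow> y \<in> Lnat_recession T \<Longrightarrow> x + y \<in> Lnat_recession T"
    using convex_cone_Lnat_recession_cone[of T]
    by (simp_all add: real_vec_add convex_cone_add convex_cone_contains_0)
qed

lemma Lnat_recession_cone_eq_hull:
  fixes T :: "(int ^ 'n) set"
  shows "Lnat_recession_cone T = convex hull (real_vec ` Lnat_recession T)" (is "?C = ?K")
proof
  have "convex ?C" using convex_cone_Lnat_recession_cone[of T] by (simp add: convex_cone_def)
  then show "?K \<subseteq> ?C"
    by (simp add: subset_hull real_vec_mem_Lnat_recession_cone image_subset_iff)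
  show "?C \<subseteq> ?K"
  proof
    fix d assume d: "d \<in> ?C"
    \<comment> \<open>\<open>None\<close> has value 0, which never exceeds a threshold
      \<open>t \<ge> 0\<close>; so the indicator is 0 there and inherits every inequality, sign
      conditions on single coordinates included.\<close>
    have up: "(\<chi> i. if d $ i > t then 1 else 0) \<in> ?K" if "t \<ge> 0" for t
    proof -
      let ?r = "(\<chi> i. if d $ i > t then 1 else 0) :: int ^ 'n"
      have "case_option 0 (vec_nth ?r) k = (if opt_axis k \<bullet> d > t then 1 else 0)" for k
        using that by (cases k) simp_all
      then have "?r \<in> Lnat_recession T"
        using d by (force simp: Lnat_recession_cone_def Lnat_recession_def)
      then have "real_vec ?r \<in> ?K" by (simp add: hull_inc)
      also have "real_vec ?r = (\<chi> i. if d $ i > t then 1 else 0)" by (simp add: vec_eq_iff)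
      finally show ?thesis .
    qed
    have down: "- (\<chi> i. if - d $ i > t then 1 else 0) \<in> ?K" if "t \<ge> 0" for t
    proof -
      let ?r = "(\<chi> i. if - d $ i > t then - 1 else 0) :: int ^ 'n"
      have "case_option 0 (vec_nth ?r) k = (if - (opt_axis k \<bullet> d) > t then - 1 else 0)" for k
        using that by (cases k) simp_all
      then have "?r \<in> Lnat_recession T"
        using d by (force simp: Lnat_recession_cone_def Lnat_recession_def)
      then have "real_vec ?r \<in> ?K" by (simp add: hull_inc)
      also have "real_vec ?r = - (\<chi> i. if - d $ i > t then 1 else 0)" by (simp add: vec_eq_iff)
      finally show ?thesis .
    qed
    \<comment> \<open>Level sets need a nonnegative vector, so the positive and negative parts are
      treated apart, the latter inside the negated cone.\<close>
    let ?u = "(\<chi> i. max (d $ i) 0) :: real ^ 'n" and ?v = "(\<chi> i. max (- d $ i) 0) :: real ^ 'n"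
    have lev: "max a 0 > t \<longleftrightarrow> a > t" if "t \<ge> 0" for a t :: real
      using that by auto
    have "?u \<in> ?K"
      by (rule mem_convex_cone_by_level_sets[OF convex_cone_hull_Lnat_recession])
        (simp_all add: lev up cong: if_cong)
    moreover have "?v \<in> uminus ` ?K"
    proof (rule mem_convex_cone_by_level_sets)
      show "convex_cone (uminus ` ?K)"
        using convex_cone_negations convex_cone_hull_Lnat_recession by blast
      show "(\<chi> i. if ?v $ i > t then 1 else 0) \<in> uminus ` ?K" if "t \<ge> 0" for t
        using down[OF that] imageI[OF down[OF that], of uminus] by (simp add: lev[OF that])
    qed simp
    ultimately have "?u + - ?v \<in> ?K"
      using convex_cone_add[OF convex_cone_hull_Lnat_recession] by force
    also have "?u + - ?v = d" by (simp add: vec_eq_iff max_def)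
    finally show "d \<in> ?K" .
  qed
qed

text \<open>Adding \<theta> and rounding down is monotone and commutes with integer constants, so it
  preserves every tight bound; \<open>None\<close> stays at 0 because \<theta> < 1. A pair without a
  bound has differences as large as needed.\<close>

lemma Lnat_round_mem:
  fixes T :: "(int ^ 'n) set"
  assumes T: "Lnat_convex T"
    and f: "\<And>i j. (i, j) \<in> diff_pairs T \<Longrightarrow> f i j \<in> diag_lift T"
    and z: "\<And>i j. (i, j) \<in> diff_pairs T \<Longrightarrow> opt_axis i \<bullet> z - opt_axis j \<bullet> z \<le> real_of_int (f i j i - f i j j)"
    and "0 \<le> \<theta>" "\<theta> < 1"
  shows "(\<chi> i. \<lfloor>z $ i + \<theta>\<rfloor>) \<in> T"
proof -
  let ?p = "\<lambda>k. \<lfloor>opt_axis k \<bullet> z + \<theta>\<rfloor>"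
  have "\<exists>g\<in>diag_lift T. ?p i - ?p j \<le> g i - g j" for i j
  proof (cases "(i, j) \<in> diff_pairs T")
    case True
    have "opt_axis i \<bullet> z + \<theta> \<le> opt_axis j \<bullet> z + \<theta> + real_of_int (f i j i - f i j j)"
      using z[OF True] by simp
    then have "?p i \<le> ?p j + (f i j i - f i j j)"
      by (metis floor_add_int floor_mono)
    then have "?p i - ?p j \<le> f i j i - f i j j" by simp
    with f[OF True] show ?thesis by blast
  next
    case False
    then have "\<not> (\<forall>f\<in>diag_lift T. f i - f j \<le> ?p i - ?p j)"
      unfolding diff_pairs_def by blast
    then show ?thesis by (meson linear)
  qed
  then have "?p \<in> diag_lift T" by (rule diag_lift_memI[OF T])
  moreover have "\<lfloor>\<theta>\<rfloor> = 0" using assms by (simp add: floor_eq_iff)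
  ultimately show ?thesis by (simp add: diag_lift_def)
qed

lemma polyhedron_recession_hull_Lnat:
  fixes T :: "(int ^ 'n) set"
  assumes T: "Lnat_convex T"
  shows "polyhedron (convex hull (real_vec ` T))"
    and "recession (convex hull (real_vec ` T)) = convex hull (real_vec ` Lnat_recession T)"
proof -
  let ?P = "convex hull (real_vec ` T)"
  let ?E = "diff_pairs T"
  have "T \<noteq> {}" using T by (simp add: Lnat_convex_def)
  then obtain t0 where t0: "t0 \<in> T" by blast
  have "\<forall>i j. \<exists>f. (i, j) \<in> ?E \<longrightarrow> f \<in> diag_lift T \<and> (\<forall>g\<in>diag_lift T. g i - g j \<le> f i - f j)"
    using diff_pairs_attained[OF \<open>T \<noteq> {}\<close>] by blast
  then obtain f where f: "\<And>i j. (i, j) \<in> ?E \<Longrightarrow> f i j \<in> diag_lift T"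
    "\<And>i j g. (i, j) \<in> ?E \<Longrightarrow> g \<in> diag_lift T \<Longrightarrow> g i - g j \<le> f i j i - f i j j"
    by metis
  define H where "H = {z. \<forall>e\<in>?E. (opt_axis (fst e) - opt_axis (snd e)) \<bullet> z
    \<le> real_of_int (f (fst e) (snd e) (fst e) - f (fst e) (snd e) (snd e))}"
  have H: "z \<in> H \<longleftrightarrow> (\<forall>i j. (i, j) \<in> ?E \<longrightarrow> opt_axis i \<bullet> z - opt_axis j \<bullet> z \<le> real_of_int (f i j i - f i j j))" for z
    by (auto simp: H_def inner_diff_left)
  have "H = (\<Inter>e\<in>?E. {z. (opt_axis (fst e) - opt_axis (snd e)) \<bullet> z
    \<le> real_of_int (f (fst e) (snd e) (fst e) - f (fst e) (snd e) (snd e))})" by (auto simp: H_def)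
  moreover have "polyhedron \<dots>"
    by (rule polyhedron_Inter) (auto intro: polyhedron_halfspace_le)
  ultimately have polyH: "polyhedron H" by simp
  have "?P \<subseteq> H"
  proof -
    have "real_vec t \<in> H" if "t \<in> T" for t
    proof -
      have "case_option 0 (vec_nth t) \<in> diag_lift T" using that by (simp add: diag_lift_def)
      from f(2)[OF _ this] show ?thesis
        by (auto simp: H opt_axis_inner_real_vec simp flip: of_int_diff)
    qed
    then show ?thesis
      using polyhedron_imp_convex[OF polyH] by (simp add: subset_hull image_subset_iff)
  qed
  moreover have "H \<subseteq> ?P"
  proof
    fix z assume z: "z \<in> H"
    have round: "real_vec (\<chi> i. \<lfloor>z $ i + \<theta>\<rfloor>) \<in> ?P" if "0 \<le> \<theta>" "\<theta> < 1" for \<theta>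
      using Lnat_round_mem[of T f z \<theta>] T f(1) z that by (simp add: H hull_inc)
    let ?z = "real_vec (\<chi> i. \<lfloor>z $ i\<rfloor>)"
    let ?v = "\<chi> i. frac (z $ i)"
    \<comment> \<open>Relative to the rounded-down point \<open>?z\<close>, the indicator of a level
      set of the fractional parts is another rounding of \<open>z\<close>; so level sets exhibit
      \<open>z\<close> as an average of roundings.\<close>
    have "?v \<in> (\<lambda>x. - ?z + x) ` ?P"
    proof (rule mem_convex_by_level_sets)
      have memI: "v \<in> (\<lambda>x. - ?z + x) ` ?P" if "?z + v \<in> ?P" for v
        using that by (intro image_eqI[of _ _ "?z + v"]) simp_all
      show "convex ((\<lambda>x. - ?z + x) ` ?P)" by (simp only: convex_translation_eq convex_convex_hull)
      show "0 \<in> (\<lambda>x. - ?z + x) ` ?P" using round[of 0] by (intro memI) simp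
      show "0 \<le> ?v $ i" "?v $ i \<le> 1" for i
        using frac_ge_0[of "z $ i"] frac_lt_1[of "z $ i"] by simp_all
      fix t :: real assume t: "0 \<le> t" "t < 1"
      show "(\<chi> i. if ?v $ i > t then 1 else 0) \<in> (\<lambda>x. - ?z + x) ` ?P"
      proof (cases "\<exists>i. frac (z $ i) > t")
        case False
        then have "(\<chi> i. if ?v $ i > t then 1 else 0) = (0 :: real ^ 'n)" by (simp add: vec_eq_iff)
        with \<open>0 \<in> (\<lambda>x. - ?z + x) ` ?P\<close> show ?thesis by simp
      next
        case True
        let ?I = "{i. frac (z $ i) > t}"
        \<comment> \<open>The level set above \<open>t\<close> consists of the fractional parts that
          are at least \<open>m\<close>, and the shift \<open>1 - m\<close> raises exactly their
          floors by one.\<close>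
        define m where "m = Min ((\<lambda>i. frac (z $ i)) ` ?I)"
        have "m \<in> (\<lambda>i. frac (z $ i)) ` ?I" unfolding m_def using True by (intro Min_in) auto
        then have m: "t < m" "m < 1" using frac_lt_1 by auto
        have m_iff: "frac (z $ i) \<ge> m \<longleftrightarrow> frac (z $ i) > t" for i
          using m(1) unfolding m_def by (auto intro!: Min_le)
        have "\<lfloor>x + (1 - m)\<rfloor> = \<lfloor>x\<rfloor> + (if frac x \<ge> m then 1 else 0)" for x :: real
          using m t frac_lt_1[of x] frac_ge_0[of x]
          by (auto simp: floor_eq_iff frac_def algebra_simps) linarith+
        then have "real_vec (\<chi> i. \<lfloor>z $ i + (1 - m)\<rfloor>) = ?z + (\<chi> i. if ?v $ i > t then 1 else 0)"
          by (simp add: vec_eq_iff m_iff)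
        then show ?thesis using round[of "1 - m"] m t by (intro memI) simp
      qed
    qed
    then have "?z + ?v \<in> ?P" by force
    also have "?z + ?v = z" by (simp add: vec_eq_iff frac_def)
    finally show "z \<in> ?P" .
  qed
  ultimately have PH: "?P = H" by blast
  then show "polyhedron ?P" using polyH by simp
  have "recession H = Lnat_recession_cone T"
  proof
    have x0: "real_vec t0 \<in> H" using t0 PH by (metis hull_inc imageI)
    show "recession H \<subseteq> Lnat_recession_cone T"
    proof
      fix d assume d: "d \<in> recession H"
      have "opt_axis i \<bullet> d - opt_axis j \<bullet> d \<le> 0" if "(i, j) \<in> ?E" for i j
      proof (rule affine_bounded_imp_nonpos)
        fix k :: nat
        have "real_vec t0 + real k *\<^sub>R d \<in> H" using recessionD_scaleR[OF d x0] by simp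
        with that show "opt_axis i \<bullet> real_vec t0 - opt_axis j \<bullet> real_vec t0 + real k * (opt_axis i \<bullet> d - opt_axis j \<bullet> d)
          \<le> real_of_int (f i j i - f i j j)"
          by (simp add: H inner_right_distrib algebra_simps)
      qed
      then show "d \<in> Lnat_recession_cone T" by (auto simp: Lnat_recession_cone_def)
    qed
    show "Lnat_recession_cone T \<subseteq> recession H"
    proof
      fix d assume d: "d \<in> Lnat_recession_cone T"
      have "x + t *\<^sub>R d \<in> H" if "x \<in> H" "t \<ge> 0" for x t
        unfolding H
      proof (intro allI impI)
        fix i j assume ij: "(i, j) \<in> ?E"
        then have "t * (opt_axis i \<bullet> d) \<le> t * (opt_axis j \<bullet> d)"
          using d \<open>t \<ge> 0\<close> by (auto simp: Lnat_recession_cone_def intro!: mult_left_mono)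
        moreover have "opt_axis i \<bullet> x - opt_axis j \<bullet> x \<le> real_of_int (f i j i - f i j j)"
          using \<open>x \<in> H\<close> ij by (simp add: H)
        ultimately show "opt_axis i \<bullet> (x + t *\<^sub>R d) - opt_axis j \<bullet> (x + t *\<^sub>R d) \<le> real_of_int (f i j i - f i j j)"
          by (simp add: inner_right_distrib)
      qed
      then show "d \<in> recession H" by (simp add: recession_def)
    qed
  qed
  then show "recession ?P = convex hull (real_vec ` Lnat_recession T)"
    by (simp add: PH Lnat_recession_cone_eq_hull)
qed

definition decomposable :: "((int ^ 'n) set \<Rightarrow> bool) \<Rightarrow> (real ^ 'n) set \<Rightarrow> bool" where
  "decomposable A P \<longleftrightarrow>
    (\<exists>Q C. convex_polyhedron_of A Q \<and> bounded Q \<and> convex_cone_of A C \<and> P = {q + c | q c. q \<in> Q \<and> c \<in> C})"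

lemma Lnat_decomposable:
  assumes "convex_polyhedron_of Lnat_convex P"
  shows "decomposable Lnat_convex P"
proof -
  obtain T where T: "Lnat_convex T" "P = convex hull (real_vec ` T)"
    using assms by (auto simp: convex_polyhedron_of_def)
  then show ?thesis
    unfolding decomposable_def
    using polyhedron_recession_hull_Lnat[OF T(1)] Lnat_convex_Int_int_box[OF T(1)] Lnat_convex_Lnat_recession[of T]
    by (intro decomposition_of_class[OF T(2), of "Lnat_recession T"]) (auto simp: Lnat_convex_def[of T])
qed

section \<open>Minkowski sums and linear images of L-natural-convex polyhedra\<close>

lemma real_vec_image_plus: "real_vec ` (S + T) = real_vec ` S + real_vec ` T"
  by (force simp: set_plus_def real_vec_add)

lemma set_plus_Collect: "S + T = {t + u | t u. t \<in> S \<and> u \<in> T}"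
  by (auto simp: set_plus_def)

lemma Lnat2_decomposable:
  fixes P :: "(real ^ 'n) set"
  assumes "convex_polyhedron_of Lnat2_convex P"
  shows "decomposable Lnat2_convex P"
proof -
  obtain T U where TU: "Lnat_convex T" "Lnat_convex U" "P = convex hull (real_vec ` (T + U))"
    using assms by (auto simp: convex_polyhedron_of_def Lnat2_convex_def simp flip: set_plus_Collect)
  have "decomposable Lnat_convex (convex hull (real_vec ` T))" "decomposable Lnat_convex (convex hull (real_vec ` U))"
    using TU by (auto intro!: Lnat_decomposable simp: convex_polyhedron_of_def)
  then obtain Q1 C1 Q2 C2 where
    1: "convex_polyhedron_of Lnat_convex Q1" "bounded Q1" "convex_cone_of Lnat_convex C1"
      "convex hull (real_vec ` T) = Q1 + C1" and
    2: "convex_polyhedron_of Lnat_convex Q2" "bounded Q2" "convex_cone_of Lnat_convex C2"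
      "convex hull (real_vec ` U) = Q2 + C2"
    by (auto simp: decomposable_def simp flip: set_plus_Collect)
  have plus: "convex_polyhedron_of Lnat2_convex (A + B)"
    if "convex_polyhedron_of Lnat_convex A" "convex_polyhedron_of Lnat_convex B" for A B :: "(real ^ 'n) set"
    using that unfolding convex_polyhedron_of_def Lnat2_convex_def set_plus_Collect[symmetric]
    by (metis convex_hull_set_plus real_vec_image_plus)
  have "P = (Q1 + Q2) + (C1 + C2)"
    by (simp add: TU(3) real_vec_image_plus convex_hull_set_plus 1(4) 2(4) add_ac)
  moreover have "cone (C1 + C2)"
    using 1(3) 2(3) by (fastforce simp: convex_cone_of_def cone_def set_plus_def scaleR_add_right)
  moreover have "bounded (Q1 + Q2)" using bounded_plus[OF 1(2) 2(2)] by (simp add: set_plus_image)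
  ultimately show ?thesis
    using plus 1 2 unfolding decomposable_def convex_cone_of_def set_plus_Collect[symmetric] by blast
qed

lemma multimodular_decomposable:
  fixes P :: "(real ^ 'n::{finite,linorder}) set"
  assumes "convex_polyhedron_of multimodular P"
  shows "decomposable multimodular P"
proof -
  let ?D = "multimodular_matrix :: int ^ ('n::{finite,linorder}) ^ ('n::{finite,linorder})"
  define D where "D = (\<chi> i j. real_of_int (?D $ i $ j))"
  have D: "real_vec (?D *v y) = D *v real_vec y" for y
    by (simp add: vec_eq_iff D_def matrix_vector_mult_def)
  have lin: "linear ((*v) D)" by (rule matrix_vector_mul_linear)
  have hull: "convex hull (real_vec ` {?D *v y | y. y \<in> T}) = (*v) D ` (convex hull (real_vec ` T))" for T
  proof -
    have "real_vec ` {?D *v y | y. y \<in> T} = (*v) D ` real_vec ` T" by (force simp: D)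
    then show ?thesis by (simp add: convex_hull_linear_image[OF lin])
  qed
  have image: "convex_polyhedron_of multimodular ((*v) D ` B)" if "convex_polyhedron_of Lnat_convex B" for B
    using that unfolding convex_polyhedron_of_def multimodular_def by (metis hull)
  obtain T where "Lnat_convex T" "P = convex hull (real_vec ` {?D *v y | y. y \<in> T})"
    using assms unfolding convex_polyhedron_of_def multimodular_def by blast
  then have T: "Lnat_convex T" "P = (*v) D ` (convex hull (real_vec ` T))"
    by (simp_all only: hull)
  have "decomposable Lnat_convex (convex hull (real_vec ` T))"
    using T by (auto intro!: Lnat_decomposable simp: convex_polyhedron_of_def)
  then obtain Q C where QC: "convex_polyhedron_of Lnat_convex Q" "bounded Q" "convex_cone_of Lnat_convex C"
      "convex hull (real_vec ` T) = Q + C"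
    by (auto simp: decomposable_def simp flip: set_plus_Collect)
  have "P = (*v) D ` Q + (*v) D ` C"
    by (force simp: T(2) QC(4) set_plus_def matrix_vector_right_distrib)
  moreover have "bounded ((*v) D ` Q)"
    using QC(2) lin by (simp add: bounded_linear_image linear_linear)
  moreover have "cone ((*v) D ` C)"
    using QC(3) by (fastforce simp: convex_cone_of_def cone_def simp flip: linear_scale[OF lin])
  ultimately show ?thesis
    using image QC unfolding decomposable_def convex_cone_of_def set_plus_Collect[symmetric] by blast
qed

section \<open>Convex hulls of M-natural-convex sets\<close>

definition sq_norm :: "int ^ 'n \<Rightarrow> int" where
  "sq_norm x = (\<Sum>i\<in>UNIV. (x $ i)\<^sup>2)"

text \<open>Lifting \<open>x\<close> to the pair of \<open>real_vec x\<close> and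
  \<open>sq_norm x\<close> turns the representations of \<open>z\<close> into a compact fibre, on
  which the last coordinate attains its minimum. Shifting equal mass from \<open>s\<close>,
  \<open>t\<close> to \<open>s'\<close>, \<open>t'\<close> stays in the fibre, so it cannot lower
  that coordinate.\<close>

lemma convex_combination_minimal_squares:
  fixes F :: "(int ^ 'n) set"
  assumes F: "finite F" and z: "z \<in> convex hull (real_vec ` F)"
  obtains u where "\<forall>x\<in>F. 0 \<le> u x" "sum u F = 1" "(\<Sum>x\<in>F. u x *\<^sub>R real_vec x) = z"
    "\<forall>s\<in>F. \<forall>t\<in>F. \<forall>s'\<in>F. \<forall>t'\<in>F. 0 < u s \<and> 0 < u t \<and> s + t = s' + t' \<longrightarrow>
       sq_norm s + sq_norm t \<le> sq_norm s' + sq_norm t'"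
proof -
  define g :: "int ^ 'n \<Rightarrow> (real ^ 'n) \<times> real" where "g x = (real_vec x, real_of_int (sq_norm x))" for x
  let ?K = "convex hull (g ` F)"
  have injv: "inj_on real_vec F" and injg: "inj_on g F"
    using inj_real_vec by (auto simp: inj_on_def g_def)
  have memK: "(\<Sum>x\<in>F. u x *\<^sub>R g x) \<in> ?K" if "\<And>x. x \<in> F \<Longrightarrow> 0 \<le> u x" "sum u F = 1" for u
    by (rule convex_sum) (auto simp: F that hull_inc)
  have g_sum: "(\<Sum>x\<in>F. u x *\<^sub>R g x) = (\<Sum>x\<in>F. u x *\<^sub>R real_vec x, \<Sum>x\<in>F. u x * real_of_int (sq_norm x))" for u
    by (simp add: g_def sum_prod)
  have compK: "compact ?K" using F by (simp add: compact_convex_hull finite_imp_compact)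
  have "compact (?K \<inter> fst -` {z})"
    by (intro compact_Int_closed compK closed_vimage continuous_intros)
  moreover have "?K \<inter> fst -` {z} \<noteq> {}"
  proof -
    obtain u where u: "\<forall>x\<in>real_vec ` F. 0 \<le> u x" "sum u (real_vec ` F) = 1" "(\<Sum>x\<in>real_vec ` F. u x *\<^sub>R x) = z"
      using z F by (auto simp: convex_hull_finite)
    then have "(\<Sum>x\<in>F. u (real_vec x) *\<^sub>R g x) \<in> ?K"
      by (intro memK) (simp_all add: sum.reindex[OF injv])
    moreover have "fst (\<Sum>x\<in>F. u (real_vec x) *\<^sub>R g x) = z"
      using u(3) by (simp add: g_sum sum.reindex[OF injv])
    ultimately show ?thesis by blast
  qed
  ultimately have "\<exists>w\<in>?K \<inter> fst -` {z}. \<forall>y\<in>?K \<inter> fst -` {z}. snd w \<le> snd y"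
    by (rule continuous_attains_inf) (intro continuous_intros)
  then obtain w where w: "w \<in> ?K" "fst w = z" "\<And>y. y \<in> ?K \<Longrightarrow> fst y = z \<Longrightarrow> snd w \<le> snd y"
    by blast
  obtain v where v: "\<forall>x\<in>g ` F. 0 \<le> v x" "sum v (g ` F) = 1" "(\<Sum>x\<in>g ` F. v x *\<^sub>R x) = w"
    using w(1) F by (auto simp: convex_hull_finite)
  define u where "u x = v (g x)" for x
  have u: "\<And>x. x \<in> F \<Longrightarrow> 0 \<le> u x" "sum u F = 1" "(\<Sum>x\<in>F. u x *\<^sub>R g x) = w"
    using v by (simp_all add: u_def sum.reindex[OF injg])
  have "sq_norm s + sq_norm t \<le> sq_norm s' + sq_norm t'"
    if mem: "s \<in> F" "t \<in> F" "s' \<in> F" "t' \<in> F" and pos: "0 < u s" "0 < u t" and eq: "s + t = s' + t'" for s t s' t'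
  proof -
    \<comment> \<open>Half of the smaller weight, because \<open>s\<close> and \<open>t\<close> may
      coincide, and then the mass is taken twice from one point.\<close>
    define e where "e = min (u s) (u t) / 2"
    have e: "e > 0" "2 * e \<le> u s" "2 * e \<le> u t" using pos by (auto simp: e_def)
    define u' where "u' x = u x + e * of_bool (x = s') + e * of_bool (x = t') - e * of_bool (x = s) - e * of_bool (x = t)" for x
    have delta: "(\<Sum>x\<in>F. (e * of_bool (x = a)) *\<^sub>R f x) = e *\<^sub>R f a" if "a \<in> F"
      for a and f :: "int ^ 'n \<Rightarrow> 'z::real_vector"
    proof -
      have "(\<Sum>x\<in>F. (e * of_bool (x = a)) *\<^sub>R f x) = (\<Sum>x\<in>F. if x = a then e *\<^sub>R f a else 0)"
        by (intro sum.cong) auto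
      then show ?thesis using F that by simp
    qed
    have sums: "(\<Sum>x\<in>F. u' x *\<^sub>R f x) = (\<Sum>x\<in>F. u x *\<^sub>R f x) + e *\<^sub>R (f s' + f t' - f s - f t)"
      for f :: "int ^ 'n \<Rightarrow> 'z::real_vector"
      unfolding u'_def scaleR_add_left scaleR_diff_left sum.distrib sum_subtractf delta[OF mem(1)] delta[OF mem(2)]
        delta[OF mem(3)] delta[OF mem(4)] by (simp add: algebra_simps)
    have "0 \<le> u' x" if "x \<in> F" for x
      using u(1)[OF that] e by (auto simp: u'_def of_bool_def)
    moreover have "sum u' F = 1" using sums[of "\<lambda>_. 1 :: real"] u(2) by simp
    ultimately have "(\<Sum>x\<in>F. u' x *\<^sub>R g x) \<in> ?K" using memK[of u'] by blast
    moreover have w': "(\<Sum>x\<in>F. u' x *\<^sub>R g x) = w + e *\<^sub>R (g s' + g t' - g s - g t)"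
      using sums[of g] u(3) by simp
    moreover have "real_vec s' + real_vec t' - real_vec s - real_vec t = 0"
      using eq by (simp add: algebra_simps flip: real_vec_add)
    then have "fst (w + e *\<^sub>R (g s' + g t' - g s - g t)) = z"
      using w(2) by (simp add: g_def)
    ultimately have "snd w \<le> snd (w + e *\<^sub>R (g s' + g t' - g s - g t))"
      using w(3) by metis
    then have "0 \<le> e * (real_of_int (sq_norm s') + real_of_int (sq_norm t') - real_of_int (sq_norm s) - real_of_int (sq_norm t))"
      by (simp add: g_def)
    then show ?thesis using e(1) by (simp add: zero_le_mult_iff)
  qed
  moreover have "(\<Sum>x\<in>F. u x *\<^sub>R real_vec x) = z" using u(3) w(2) by (auto simp: g_sum)
  ultimately show thesis using that u(1,2) by blast
qed

lemma axis_nth: "axis i c $ k = (if k = i then c else 0)"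
  by (auto simp: axis_def)

text \<open>Two integers at distance at least 2 that move one step towards each other lower their
  sum of squares; at coordinate \<open>j\<close> the distance may be 1, where they only
  swap.\<close>

lemma sq_norm_exchange:
  fixes s t :: "int ^ 'n"
  assumes "s $ i - t $ i \<ge> 2"
  shows "sq_norm (s - axis i 1) + sq_norm (t + axis i 1) < sq_norm s + sq_norm t"
    and "s $ j < t $ j \<Longrightarrow> sq_norm (s - axis i 1 + axis j 1) + sq_norm (t + axis i 1 - axis j 1) < sq_norm s + sq_norm t"
proof -
  have sq_axis: "sq_norm (x + axis k c) = sq_norm x + 2 * c * x $ k + c\<^sup>2" for x :: "int ^ 'n" and k c
  proof -
    have "((x + axis k c) $ l)\<^sup>2 = (x $ l)\<^sup>2 + (if l = k then 2 * c * x $ k + c\<^sup>2 else 0)" for l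
      by (simp add: axis_nth power2_sum)
    then show ?thesis by (simp add: sq_norm_def sum.distrib)
  qed
  have sq_axis': "sq_norm (x - axis k 1) = sq_norm x - 2 * x $ k + 1" for x :: "int ^ 'n" and k
  proof -
    have "x - axis k 1 = x + axis k (- 1)" by (simp add: vec_eq_iff axis_nth)
    then show ?thesis using sq_axis[of x k "- 1"] by (simp only: power2_minus) simp
  qed
  show "sq_norm (s - axis i 1) + sq_norm (t + axis i 1) < sq_norm s + sq_norm t"
    using assms by (simp add: sq_axis sq_axis')
  assume "s $ j < t $ j"
  moreover from this assms have "i \<noteq> j" by auto
  ultimately show "sq_norm (s - axis i 1 + axis j 1) + sq_norm (t + axis i 1 - axis j 1) < sq_norm s + sq_norm t"
    using assms by (simp add: sq_axis sq_axis' axis_nth)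
qed

lemma int_box_between:
  assumes "x \<in> int_box b" "y \<in> int_box b"
    and "\<And>k. min (x $ k) (y $ k) \<le> z $ k" "\<And>k. z $ k \<le> max (x $ k) (y $ k)"
  shows "z \<in> int_box b"
  unfolding int_box_def
proof (intro CollectI allI)
  fix k
  have "\<bar>x $ k\<bar> \<le> b" "\<bar>y $ k\<bar> \<le> b" using assms(1,2) by (simp_all add: int_box_def)
  with assms(3)[of k] assms(4)[of k] show "\<bar>z $ k\<bar> \<le> b" by linarith
qed

text \<open>All these points lie coordinatewise between \<open>x\<close> and \<open>y\<close>, so
  the exchange axioms survive intersection with a box.\<close>

lemma int_box_exchange:
  fixes x y :: "int ^ 'n"
  assumes "x \<in> int_box b" "y \<in> int_box b" "x $ i > y $ i"
  shows "x - axis i 1 \<in> int_box b" "y + axis i 1 \<in> int_box b"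
    and "x $ j < y $ j \<Longrightarrow> x - axis i 1 + axis j 1 \<in> int_box b"
    and "x $ j < y $ j \<Longrightarrow> y + axis i 1 - axis j 1 \<in> int_box b"
  using assms(3) by (auto intro!: int_box_between[OF assms(1,2)] simp: axis_nth min_def max_def)

lemma Mnat_convex_Int_int_box:
  fixes T :: "(int ^ 'n) set"
  assumes "Mnat_convex T" "T \<inter> int_box b \<noteq> {}"
  shows "Mnat_convex (T \<inter> int_box b)"
proof -
  have "(x - axis i 1 \<in> T \<inter> int_box b \<and> y + axis i 1 \<in> T \<inter> int_box b) \<or>
      (\<exists>j. x $ j < y $ j \<and> x - axis i 1 + axis j 1 \<in> T \<inter> int_box b \<and> y + axis i 1 - axis j 1 \<in> T \<inter> int_box b)"
    if "x \<in> T \<inter> int_box b" "y \<in> T \<inter> int_box b" "x $ i > y $ i" for x y i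
    using assms(1) that int_box_exchange[of x b y i] unfolding Mnat_convex_def by (metis IntD1 IntD2 IntI)
  then show ?thesis using assms(2) unfolding Mnat_convex_def by blast
qed

lemma M_convex_Int_int_box:
  fixes T :: "(int ^ 'n) set"
  assumes "M_convex T" "T \<inter> int_box b \<noteq> {}"
  shows "M_convex (T \<inter> int_box b)"
proof -
  have "\<exists>j. x $ j < y $ j \<and> x - axis i 1 + axis j 1 \<in> T \<inter> int_box b \<and> y + axis i 1 - axis j 1 \<in> T \<inter> int_box b"
    if "x \<in> T \<inter> int_box b" "y \<in> T \<inter> int_box b" "x $ i > y $ i" for x y i
    using assms(1) that int_box_exchange[of x b y i] unfolding M_convex_def by (metis IntD1 IntD2 IntI)
  then show ?thesis using assms(2) unfolding M_convex_def by blast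
qed

text \<open>A representation of \<open>z\<close> minimising the weighted sum of squares has no two points at distance
  at least \<open>2\<close> in some coordinate, since exchanging them would decrease that sum.\<close>

lemma Mnat_hull_local:
  fixes T :: "(int ^ 'n) set"
  assumes T: "Mnat_convex T" and z: "z \<in> convex hull (real_vec ` T)"
  obtains H u where "finite H" "H \<subseteq> T" "\<forall>x\<in>H. 0 < u x" "sum u H = 1"
    "(\<Sum>x\<in>H. u x *\<^sub>R real_vec x) = z" "\<forall>s\<in>H. \<forall>t\<in>H. \<forall>i. s $ i \<le> t $ i + 1"
proof -
  obtain G v where G: "finite G" "G \<subseteq> real_vec ` T" "\<forall>x\<in>G. 0 \<le> v x" "sum v G = 1" "(\<Sum>x\<in>G. v x *\<^sub>R x) = z"
    using z unfolding convex_hull_explicit by blast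
  obtain F0 where F0: "F0 \<subseteq> T" "finite F0" "G = real_vec ` F0" using finite_subset_image[OF G(1,2)] by blast
  \<comment> \<open>The minimisation needs a finite set that is closed under exchanges and carries a
    representation of \<open>z\<close>: the part of \<open>T\<close> in a box around one
    representation.\<close>
  obtain b where b: "F0 \<subseteq> int_box b" using finite_subset_int_box[OF F0(2)] by blast
  define F where "F = T \<inter> int_box b"
  have finF: "finite F" using finite_int_box by (auto simp: F_def)
  have "z \<in> convex hull G" using G by (auto simp: convex_hull_finite)
  moreover have "G \<subseteq> real_vec ` F" using F0 b by (auto simp: F_def)
  ultimately have zF: "z \<in> convex hull (real_vec ` F)" using hull_mono by blast
  then have "F \<noteq> {}" by auto
  then have Mn: "Mnat_convex F" using Mnat_convex_Int_int_box[OF T] by (simp add: F_def)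
  obtain u where u: "\<forall>x\<in>F. 0 \<le> u x" "sum u F = 1" "(\<Sum>x\<in>F. u x *\<^sub>R real_vec x) = z"
    and min: "\<forall>s\<in>F. \<forall>t\<in>F. \<forall>s'\<in>F. \<forall>t'\<in>F. 0 < u s \<and> 0 < u t \<and> s + t = s' + t' \<longrightarrow>
       sq_norm s + sq_norm t \<le> sq_norm s' + sq_norm t'"
    using convex_combination_minimal_squares[OF finF zF] .
  define H where "H = {x \<in> F. 0 < u x}"
  have HF: "H \<subseteq> F" by (auto simp: H_def)
  have zero: "\<forall>x\<in>F - H. u x = 0" using u(1) by (force simp: H_def)
  have sum1: "sum u H = 1" using sum.mono_neutral_left[OF finF HF zero] u(2) by simp
  have sumz: "(\<Sum>x\<in>H. u x *\<^sub>R real_vec x) = z"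
    using sum.mono_neutral_left[OF finF HF, of "\<lambda>x. u x *\<^sub>R real_vec x"] zero u(3) by simp
  have close: "\<forall>s\<in>H. \<forall>t\<in>H. \<forall>i. s $ i \<le> t $ i + 1"
  proof (intro ballI allI)
    fix s t i assume st: "s \<in> H" "t \<in> H"
    show "s $ i \<le> t $ i + 1"
    proof (rule ccontr)
      assume "\<not> s $ i \<le> t $ i + 1"
      then have d: "s $ i - t $ i \<ge> 2" by simp
      have mem: "s \<in> F" "t \<in> F" "0 < u s" "0 < u t" using st by (auto simp: H_def)
      have "(s - axis i 1 \<in> F \<and> t + axis i 1 \<in> F) \<or>
          (\<exists>j. s $ j < t $ j \<and> s - axis i 1 + axis j 1 \<in> F \<and> t + axis i 1 - axis j 1 \<in> F)"
        using Mn mem(1,2) d unfolding Mnat_convex_def by auto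
      then show False
      proof (elim disjE exE conjE)
        assume "s - axis i 1 \<in> F" "t + axis i 1 \<in> F"
        with min mem have "sq_norm s + sq_norm t \<le> sq_norm (s - axis i 1) + sq_norm (t + axis i 1)" by simp
        with sq_norm_exchange(1)[OF d] show False by simp
      next
        fix j assume j: "s $ j < t $ j" "s - axis i 1 + axis j 1 \<in> F" "t + axis i 1 - axis j 1 \<in> F"
        with min mem have "sq_norm s + sq_norm t \<le> sq_norm (s - axis i 1 + axis j 1) + sq_norm (t + axis i 1 - axis j 1)"
          by simp
        with sq_norm_exchange(2)[OF d j(1)] show False by simp
      qed
    qed
  qed
  have "finite H" "H \<subseteq> T" using finite_subset[OF HF finF] HF by (auto simp: F_def)
  moreover have "\<forall>x\<in>H. 0 < u x" by (simp add: H_def)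
  ultimately show thesis using that[of H u] sum1 sumz close by blast
qed

text \<open>The points of a local representation differ by at most 1 in each coordinate, hence so
  does each of them from the average. This provides lattice points near a real ray.\<close>

lemma Mnat_hull_near:
  fixes T :: "(int ^ 'n) set"
  assumes T: "Mnat_convex T" and z: "z \<in> convex hull (real_vec ` T)"
  shows "\<exists>p\<in>T. \<forall>i. \<bar>real_of_int (p $ i) - z $ i\<bar> \<le> 1"
proof -
  obtain H u where H: "finite H" "H \<subseteq> T" "\<forall>x\<in>H. 0 < u x" "sum u H = 1"
    "(\<Sum>x\<in>H. u x *\<^sub>R real_vec x) = z" "\<forall>s\<in>H. \<forall>t\<in>H. \<forall>i. s $ i \<le> t $ i + 1"
    using Mnat_hull_local[OF assms] .
  then obtain p where p: "p \<in> H" by fastforce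
  have "\<bar>real_of_int (p $ i) - z $ i\<bar> \<le> 1" for i
  proof -
    have "real_of_int (p $ i) - z $ i = (\<Sum>x\<in>H. u x * real_of_int (p $ i - x $ i))"
      using H(4) by (simp add: H(5)[symmetric] right_diff_distrib sum_subtractf flip: sum_distrib_right)
    also have "\<bar>\<dots>\<bar> \<le> (\<Sum>x\<in>H. \<bar>u x * real_of_int (p $ i - x $ i)\<bar>)" by (rule sum_abs)
    also have "\<dots> \<le> (\<Sum>x\<in>H. u x)"
    proof (rule sum_mono)
      fix x assume x: "x \<in> H"
      have "\<bar>p $ i - x $ i\<bar> \<le> 1" using H(6) p x by (smt (verit, best))
      then have "\<bar>real_of_int (p $ i - x $ i)\<bar> \<le> 1" by linarith
      then show "\<bar>u x * real_of_int (p $ i - x $ i)\<bar> \<le> u x"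
        using H(3) x mult_left_le[of "\<bar>real_of_int (p $ i - x $ i)\<bar>" "u x"] by (auto simp: abs_mult)
    qed
    finally show ?thesis using H(4) by simp
  qed
  with p H(2) show ?thesis by blast
qed

text \<open>If a point of a local representation exceeded \<open>p\<close> in some coordinate, all
  the others would be at least \<open>p\<close> there, and the average could not equal
  \<open>p\<close>; likewise from below.\<close>

lemma Mnat_hull_integral:
  fixes T :: "(int ^ 'n) set"
  assumes T: "Mnat_convex T" and z: "real_vec p \<in> convex hull (real_vec ` T)"
  shows "p \<in> T"
proof -
  obtain H u where H: "finite H" "H \<subseteq> T" "\<forall>x\<in>H. 0 < u x" "sum u H = 1"
    "(\<Sum>x\<in>H. u x *\<^sub>R real_vec x) = real_vec p" "\<forall>s\<in>H. \<forall>t\<in>H. \<forall>i. s $ i \<le> t $ i + 1"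
    using Mnat_hull_local[OF assms] .
  then obtain s where s: "s \<in> H" by fastforce
  have sum0: "(\<Sum>x\<in>H. u x * real_of_int (x $ i - p $ i)) = 0" for i
  proof -
    have "(\<Sum>x\<in>H. u x *\<^sub>R real_vec x) $ i = real_of_int (p $ i)" by (simp add: H(5))
    then show ?thesis
      using H(4) by (simp add: right_diff_distrib sum_subtractf flip: sum_distrib_right)
  qed
  have "s $ i = p $ i" for i
  proof (rule ccontr)
    assume "s $ i \<noteq> p $ i"
    then consider "s $ i > p $ i" | "s $ i < p $ i" by linarith
    then show False
    proof cases
      case 1
      have "x $ i - p $ i \<ge> 0" if "x \<in> H" for x using H(6) s that 1 by (smt (verit, best))
      then have "0 < (\<Sum>x\<in>H. u x * real_of_int (x $ i - p $ i))"
        using 1 H(1,3) s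
        by (intro sum_pos2[of H s]) (auto intro!: mult_pos_pos mult_nonneg_nonneg simp: less_imp_le simp del: of_int_diff)
      then show False using sum0[of i] by simp
    next
      case 2
      have "p $ i - x $ i \<ge> 0" if "x \<in> H" for x using H(6) s that 2 by (smt (verit, best))
      then have "0 < (\<Sum>x\<in>H. u x * real_of_int (p $ i - x $ i))"
        using 2 H(1,3) s
        by (intro sum_pos2[of H s]) (auto intro!: mult_pos_pos mult_nonneg_nonneg simp: less_imp_le simp del: of_int_diff)
      also have "\<dots> = - (\<Sum>x\<in>H. u x * real_of_int (x $ i - p $ i))"
        by (simp add: right_diff_distrib sum_subtractf)
      finally show False using sum0[of i] by simp
    qed
  qed
  then have "s = p" by (simp add: vec_eq_iff)
  with s H(2) show ?thesis by blast
qed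

section \<open>Exchange and asymptotic directions\<close>

text \<open>Coordinate \<open>None\<close> carries minus the coordinate sum, so that the first alternative of the
  exchange axiom becomes an exchange with \<open>None\<close>.\<close>

definition sum_lift :: "int ^ 'n \<Rightarrow> int ^ 'n option" where
  "sum_lift x = (\<chi> k. case k of None \<Rightarrow> - (\<Sum>i\<in>UNIV. x $ i) | Some i \<Rightarrow> x $ i)"

definition sum_unlift :: "int ^ 'n option \<Rightarrow> int ^ 'n" where
  "sum_unlift y = (\<chi> i. y $ Some i)"

lemma sum_lift_nth [simp]: "sum_lift x $ None = - (\<Sum>i\<in>UNIV. x $ i)" "sum_lift x $ Some i = x $ i"
  by (simp_all add: sum_lift_def)

lemma sum_unlift_nth [simp]: "sum_unlift y $ i = y $ Some i"
  by (simp add: sum_unlift_def)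

lemma sum_unlift_lift [simp]: "sum_unlift (sum_lift x) = x"
  by (simp add: vec_eq_iff)

lemma vec_option_eq_iff: "x = y \<longleftrightarrow> x $ None = y $ None \<and> (\<forall>i. x $ Some i = y $ Some i)"
  unfolding vec_eq_iff by (metis not_None_eq)

lemma sum_lift_add: "sum_lift (x + y) = sum_lift x + sum_lift y"
  and sum_lift_diff: "sum_lift (x - y) = sum_lift x - sum_lift y"
  by (simp_all add: vec_option_eq_iff sum.distrib sum_subtractf)

lemma sum_axis [simp]: "(\<Sum>k\<in>UNIV. axis i c $ k) = c"
  by (simp add: axis_nth)

lemma sum_lift_axis: "sum_lift (axis i 1) = axis (Some i) 1 - axis None 1"
  by (auto simp: vec_option_eq_iff axis_nth)

lemma sum_sum_lift [simp]: "(\<Sum>k\<in>UNIV. sum_lift x $ k) = 0"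
  by (simp add: UNIV_option_conv sum.reindex)

lemma sum_abs_decreases:
  fixes x y z :: "int ^ 'n"
  assumes "\<And>k. \<bar>z $ k - y $ k\<bar> \<le> \<bar>x $ k - y $ k\<bar>" "\<bar>z $ i - y $ i\<bar> < \<bar>x $ i - y $ i\<bar>"
  shows "nat (\<Sum>k\<in>UNIV. \<bar>z $ k - y $ k\<bar>) < nat (\<Sum>k\<in>UNIV. \<bar>x $ k - y $ k\<bar>)"
proof -
  have "(\<Sum>k\<in>UNIV. \<bar>z $ k - y $ k\<bar>) < (\<Sum>k\<in>UNIV. \<bar>x $ k - y $ k\<bar>)"
    by (rule sum_strict_mono_ex1) (use assms in auto)
  moreover have "0 \<le> (\<Sum>k\<in>UNIV. \<bar>z $ k - y $ k\<bar>)" by (simp add: sum_nonneg)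
  ultimately show ?thesis by linarith
qed

lemma exchange_closer:
  fixes x y :: "int ^ 'n"
  assumes "x $ i > y $ i" "x $ j < y $ j"
  shows "nat (\<Sum>k\<in>UNIV. \<bar>(x - axis i 1 + axis j 1) $ k - y $ k\<bar>) < nat (\<Sum>k\<in>UNIV. \<bar>x $ k - y $ k\<bar>)"
  by (rule sum_abs_decreases[of _ _ _ i]) (use assms in \<open>auto simp: axis_nth\<close>)

text \<open>These are the exchanges with coordinate \<open>None\<close> of the sum lift. If the
  axiom offers only a swap, replacing one of the two points by its swapped version keeps the sums
  and brings the pair closer. Replacing \<open>y\<close> yields the raise of \<open>x\<close>,
  replacing \<open>x\<close> the lowering of \<open>y\<close>, so the two coordinates may
  differ.\<close>

lemma Mnat_sum_less_exchange:
  fixes T :: "(int ^ 'n) set"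
  assumes T: "Mnat_convex T" and "x \<in> T" "y \<in> T" "(\<Sum>k\<in>UNIV. x $ k) < (\<Sum>k\<in>UNIV. y $ k)"
  shows "(\<exists>j. x $ j < y $ j \<and> x + axis j 1 \<in> T) \<and> (\<exists>j. x $ j < y $ j \<and> y - axis j 1 \<in> T)"
  using assms(2-)
proof (induction "nat (\<Sum>k\<in>UNIV. \<bar>y $ k - x $ k\<bar>)" arbitrary: x y rule: less_induct)
  case less
  obtain j where j: "y $ j > x $ j"
    using less.prems(3) by (meson not_le sum_mono)
  then consider "y - axis j 1 \<in> T" "x + axis j 1 \<in> T"
    | l where "y $ l < x $ l" "y - axis j 1 + axis l 1 \<in> T" "x + axis j 1 - axis l 1 \<in> T"
    using T less.prems(1,2) unfolding Mnat_convex_def by blast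
  then show ?case
  proof cases
    case 1
    with j show ?thesis by blast
  next
    case 2
    let ?y = "y - axis j 1 + axis l 1" and ?x = "x + axis j 1 - axis l 1"
    have sums: "(\<Sum>k\<in>UNIV. ?y $ k) = (\<Sum>k\<in>UNIV. y $ k)" "(\<Sum>k\<in>UNIV. ?x $ k) = (\<Sum>k\<in>UNIV. x $ k)"
      by (simp_all add: sum.distrib sum_subtractf)
    have "\<exists>m. x $ m < ?y $ m \<and> x + axis m 1 \<in> T"
      using less.hyps[of ?y x] exchange_closer[OF j 2(1)] less.prems 2 sums by auto
    then obtain m where m: "x $ m < ?y $ m" "x + axis m 1 \<in> T" by blast
    have "x $ m < y $ m" using m(1) 2(1) by (auto simp: axis_nth split: if_splits)
    have eqx: "x - axis l 1 + axis j 1 = ?x" by (simp add: algebra_simps)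
    have "nat (\<Sum>k\<in>UNIV. \<bar>y $ k - ?x $ k\<bar>) < nat (\<Sum>k\<in>UNIV. \<bar>y $ k - x $ k\<bar>)"
      using exchange_closer[OF 2(1) j] unfolding eqx by (simp only: abs_minus_commute)
    then have "\<exists>m. ?x $ m < y $ m \<and> y - axis m 1 \<in> T"
      using less.hyps[of y ?x] less.prems 2 sums by auto
    then obtain m' where m': "?x $ m' < y $ m'" "y - axis m' 1 \<in> T" by blast
    have "x $ m' < y $ m'" using m'(1) 2(1) by (auto simp: axis_nth split: if_splits)
    then show ?thesis using m m' \<open>x $ m < y $ m\<close> by blast
  qed
qed

text \<open>The two halves of an exchange may use different \<open>j\<close>, as
  \<open>Mnat_sum_less_exchange\<close> produces them.\<close>

definition weak_exchange :: "(int ^ 'm) set \<Rightarrow> bool" where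
  "weak_exchange W \<longleftrightarrow> (\<forall>x\<in>W. \<forall>y\<in>W. \<forall>i. x $ i > y $ i \<longrightarrow>
     (\<exists>j. x $ j < y $ j \<and> x - axis i 1 + axis j 1 \<in> W) \<and>
     (\<exists>j. x $ j < y $ j \<and> y + axis i 1 - axis j 1 \<in> W))"

lemma weak_exchange_sum_lift:
  fixes T :: "(int ^ 'n) set"
  assumes T: "Mnat_convex T"
  shows "weak_exchange (sum_lift ` T)"
  unfolding weak_exchange_def
proof (intro ballI allI impI)
  fix X Y i assume "X \<in> sum_lift ` T" "Y \<in> sum_lift ` T" and i: "X $ i > Y $ i"
  then obtain x y where x: "x \<in> T" "X = sum_lift x" and y: "y \<in> T" "Y = sum_lift y" by blast
  let ?s = "\<lambda>x :: int ^ 'n. \<Sum>k\<in>UNIV. x $ k"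
  let ?A = "\<exists>j. X $ j < Y $ j \<and> X - axis i 1 + axis j 1 \<in> sum_lift ` T"
  let ?B = "\<exists>j. X $ j < Y $ j \<and> Y + axis i 1 - axis j 1 \<in> sum_lift ` T"
  have AI: ?A if "X $ j < Y $ j" "z \<in> T" "sum_lift z = X - axis i 1 + axis j 1" for j z
    using that by (metis imageI)
  have BI: ?B if "X $ j < Y $ j" "z \<in> T" "sum_lift z = Y + axis i 1 - axis j 1" for j z
    using that by (metis imageI)
  note lifts = x(2) y(2) sum_lift_add sum_lift_diff sum_lift_axis
  show "?A \<and> ?B"
  proof (cases i)
    case None
    then have "?s x < ?s y" using i by (simp add: x y)
    then obtain j j' where j: "x $ j < y $ j" "x + axis j 1 \<in> T" "x $ j' < y $ j'" "y - axis j' 1 \<in> T"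
      using Mnat_sum_less_exchange[OF T x(1) y(1)] by blast
    have ?A by (rule AI[of "Some j", OF _ j(2)]) (simp_all add: j lifts None)
    moreover have ?B by (rule BI[of "Some j'", OF _ j(4)]) (simp_all add: j lifts None)
    ultimately show ?thesis ..
  next
    case (Some a)
    then have a: "x $ a > y $ a" using i by (simp add: x y)
    then consider "x - axis a 1 \<in> T" "y + axis a 1 \<in> T"
      | j where "x $ j < y $ j" "x - axis a 1 + axis j 1 \<in> T" "y + axis a 1 - axis j 1 \<in> T"
      using T x(1) y(1) unfolding Mnat_convex_def by blast
    then show ?thesis
    proof cases
      case 1
      show ?thesis
      \<comment> \<open>A larger sum means a smaller \<open>None\<close> coordinate, and the
        uncompensated move is then an exchange with \<open>None\<close>. Otherwise the move makes
        the sums strictly different, and a compensating coordinate exists.\<close>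
      proof (cases "?s x > ?s y")
        case True
        have ?A by (rule AI[of None, OF _ 1(1)]) (simp_all add: True lifts Some)
        moreover have ?B by (rule BI[of None, OF _ 1(2)]) (simp_all add: True lifts Some)
        ultimately show ?thesis ..
      next
        case False
        then have "?s (x - axis a 1) < ?s y" "?s x < ?s (y + axis a 1)"
          by (simp_all add: sum.distrib sum_subtractf)
        then obtain j j' where
          j: "(x - axis a 1) $ j < y $ j" "x - axis a 1 + axis j 1 \<in> T" and
          j': "x $ j' < (y + axis a 1) $ j'" "y + axis a 1 - axis j' 1 \<in> T"
          using Mnat_sum_less_exchange[OF T 1(1) y(1)] Mnat_sum_less_exchange[OF T x(1) 1(2)] by blast
        have "x $ j < y $ j" "x $ j' < y $ j'"
          using j(1) j'(1) a by (auto simp: axis_nth split: if_splits)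
        have ?A by (rule AI[of "Some j", OF _ j(2)]) (simp_all add: \<open>x $ j < y $ j\<close> lifts Some)
        moreover have ?B by (rule BI[of "Some j'", OF _ j'(2)]) (simp_all add: \<open>x $ j' < y $ j'\<close> lifts Some)
        ultimately show ?thesis ..
      qed
    next
      case 2
      have ?A by (rule AI[of "Some j", OF _ 2(2)]) (simp_all add: 2(1) lifts Some)
      moreover have ?B by (rule BI[of "Some j", OF _ 2(3)]) (simp_all add: 2(1) lifts Some)
      ultimately show ?thesis ..
    qed
  qed
qed

text \<open>Coordinate \<open>i\<close> is raised one unit at a time; each exchange lowers a
  coordinate that still lies above \<open>p\<close>, so no lowered coordinate falls below
  \<open>p\<close>.\<close>

lemma weak_exchange_raise:
  fixes W :: "(int ^ 'm) set"
  assumes W: "weak_exchange W" "x \<in> W" "p \<in> W" and k: "x $ i + int k \<le> p $ i"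
  shows "\<exists>y\<in>W. y $ i = x $ i + int k \<and> (\<forall>j. j \<noteq> i \<longrightarrow> y $ j \<le> x $ j \<and> (y $ j < x $ j \<longrightarrow> p $ j \<le> y $ j))"
  using k
proof (induction k)
  case 0
  with W(2) show ?case by auto
next
  case (Suc k)
  then obtain y where y: "y \<in> W" "y $ i = x $ i + int k"
    "\<forall>j. j \<noteq> i \<longrightarrow> y $ j \<le> x $ j \<and> (y $ j < x $ j \<longrightarrow> p $ j \<le> y $ j)" by auto
  then have "p $ i > y $ i" using Suc.prems by simp
  then obtain j where j: "p $ j < y $ j" "y + axis i 1 - axis j 1 \<in> W"
    using W(1,3) y(1) unfolding weak_exchange_def by blast
  then have "j \<noteq> i" using \<open>p $ i > y $ i\<close> by auto
  then show ?case
    using j y(2,3) by (intro bexI[OF _ j(2)]) (auto simp: axis_nth)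
qed

text \<open>A decrease at \<open>j\<close> towards \<open>y\<close> must be compensated where
  \<open>y\<close> is larger, and only \<open>i\<close> is left for that.\<close>

lemma weak_exchange_direction:
  fixes W :: "(int ^ 'm) set"
  assumes W: "weak_exchange W" "x \<in> W" "y \<in> W"
    and le: "\<And>l. l \<noteq> i \<Longrightarrow> y $ l \<le> x $ l" and "j \<noteq> i" and k: "int k \<le> x $ j - y $ j"
  shows "x + int k *s (axis i 1 - axis j 1) \<in> W"
  using k
proof (induction k)
  case 0
  with W(2) show ?case by (simp add: vec.scale_zero_left)
next
  case (Suc k)
  let ?z = "x + int k *s (axis i 1 - axis j 1)"
  have z: "?z \<in> W" using Suc by simp
  have znth: "?z $ l = x $ l + int k * (of_bool (l = i) - of_bool (l = j))" for l
    by (simp add: axis_nth)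
  have "?z $ j > y $ j" unfolding znth using Suc.prems \<open>j \<noteq> i\<close> by simp
  then obtain l where l: "?z $ l < y $ l" "?z - axis j 1 + axis l 1 \<in> W"
    using W(1,3) z unfolding weak_exchange_def by blast
  have "l = i"
  proof (rule ccontr)
    assume "l \<noteq> i"
    moreover from this l(1) \<open>?z $ j > y $ j\<close> have "l \<noteq> j" by auto
    ultimately show False using l(1) le[of l] unfolding znth by simp
  qed
  moreover have "?z - axis j 1 + axis i 1 = x + int (Suc k) *s (axis i 1 - axis j 1)"
    by (simp add: vec_eq_iff algebra_simps)
  ultimately show ?case using l(2) by metis
qed

text \<open>The coordinate sum is fixed, so raising \<open>i\<close> to its value in
  \<open>p\<close> is paid for by the other coordinates; by averaging, one of them pays at least
  \<open>N\<close>, and \<open>weak_exchange_direction\<close> applies to it.\<close>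

lemma weak_exchange_large_coordinate:
  fixes W :: "(int ^ 'm) set"
  assumes W: "weak_exchange W" "x \<in> W" "p \<in> W"
    and sum0: "\<And>w. w \<in> W \<Longrightarrow> (\<Sum>k\<in>UNIV. w $ k) = 0"
    and "N > 0" and large: "p $ i - x $ i \<ge> int N * int CARD('m)"
  shows "\<exists>j. p $ j < x $ j \<and> (\<forall>k\<le>N. x + int k *s (axis i 1 - axis j 1) \<in> W)"
proof -
  have "x $ i + int (nat (p $ i - x $ i)) = p $ i"
    using large by (smt (verit) mult_nonneg_nonneg nat_0_le of_nat_0_le_iff)
  then obtain y where y: "y \<in> W" "y $ i = p $ i"
    "\<And>j. j \<noteq> i \<Longrightarrow> y $ j \<le> x $ j" "\<And>j. j \<noteq> i \<Longrightarrow> y $ j < x $ j \<Longrightarrow> p $ j \<le> y $ j"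
    using weak_exchange_raise[OF W, of i "nat (p $ i - x $ i)"] by auto
  have "\<exists>j\<in>UNIV - {i}. x $ j - y $ j \<ge> int N"
  proof (rule ccontr)
    assume "\<not> ?thesis"
    then have "(\<Sum>j\<in>UNIV - {i}. x $ j - y $ j) \<le> of_nat (card (UNIV - {i})) * (int N - 1)"
      by (intro sum_bounded_above) force
    also have "\<dots> \<le> int CARD('m) * (int N - 1)"
      using \<open>N > 0\<close> by (intro mult_right_mono) (simp_all add: card_Diff_subset)
    also have "\<dots> < int N * int CARD('m)" by (simp add: algebra_simps)
    finally have "(\<Sum>j\<in>UNIV - {i}. x $ j - y $ j) < p $ i - x $ i" using large by simp
    moreover have "(\<Sum>j\<in>UNIV. x $ j - y $ j) = (x $ i - y $ i) + (\<Sum>j\<in>UNIV - {i}. x $ j - y $ j)"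
      by (simp add: sum.remove)
    moreover have "(\<Sum>j\<in>UNIV. x $ j - y $ j) = 0"
      using sum0[OF W(2)] sum0[OF y(1)] by (simp add: sum_subtractf)
    ultimately show False using y(2) by simp
  qed
  then obtain j where j: "j \<noteq> i" "x $ j - y $ j \<ge> int N" by auto
  have "p $ j < x $ j" using y(4)[of j] j \<open>N > 0\<close> by simp
  moreover have "x + int k *s (axis i 1 - axis j 1) \<in> W" if "k \<le> N" for k
    using that j by (intro weak_exchange_direction[OF W(1,2) y(1) y(3)]) simp_all
  ultimately show ?thesis by blast
qed

text \<open>The sum of the failure indices of all candidates would be an index at which every
  candidate fails.\<close>

lemma finite_uniform_witness:
  fixes P :: "nat \<Rightarrow> 'a \<Rightarrow> bool"
  assumes "finite A" "\<And>n. \<exists>a\<in>A. P n a" "\<And>m n a. m \<le> n \<Longrightarrow> P n a \<Longrightarrow> P m a"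
  shows "\<exists>a\<in>A. \<forall>n. P n a"
proof (rule ccontr)
  assume "\<not> ?thesis"
  then obtain f where f: "\<And>a. a \<in> A \<Longrightarrow> \<not> P (f a) a" by metis
  obtain a where "a \<in> A" "P (sum f A) a" using assms(2) by blast
  then show False using f assms(3) member_le_sum[of a A f] assms(1) by auto
qed

text \<open>Among the points that are far from \<open>x\<close> in the direction of \<open>X\<close>, one closest to \<open>x\<close> exceeds \<open>x\<close>
  only inside \<open>X\<close> and is below \<open>x\<close> only outside \<open>X\<close>, since otherwise an exchange brings it closer.\<close>

lemma weak_exchange_unbounded_set:
  fixes W :: "(int ^ 'm) set"
  assumes W: "weak_exchange W" "x \<in> W"
    and sum0: "\<And>w. w \<in> W \<Longrightarrow> (\<Sum>k\<in>UNIV. w $ k) = 0"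
    and unb: "\<And>N :: nat. \<exists>p\<in>W. (\<Sum>k\<in>X. p $ k - x $ k) \<ge> int N"
  shows "\<exists>i\<in>X. \<exists>j. j \<notin> X \<and> (\<forall>k::nat. x + int k *s (axis i 1 - axis j 1) \<in> W)"
proof -
  have step: "\<exists>a\<in>{(i, j). i \<in> X \<and> j \<notin> X}. \<forall>k\<le>N. x + int k *s (axis (fst a) 1 - axis (snd a) 1) \<in> W" (is "?P N")
    if "N > 0" for N
  proof -
    let ?c = "CARD('m)"
    let ?d = "\<lambda>p :: int ^ 'm. \<Sum>k\<in>X. p $ k - x $ k"
    \<comment> \<open>One factor \<open>?c\<close> is lost when the excess is spread over the
      coordinates in \<open>X\<close>, the other in
      \<open>weak_exchange_large_coordinate\<close>.\<close>
    let ?far = "\<lambda>p. p \<in> W \<and> ?d p \<ge> int (N * ?c * ?c)"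
    obtain p0 where "?far p0" using unb by blast
    from ex_has_least_nat[of ?far, OF this, of "\<lambda>p. nat (\<Sum>k\<in>UNIV. \<bar>p $ k - x $ k\<bar>)"]
    obtain p where p: "p \<in> W" "?d p \<ge> int (N * ?c * ?c)"
      and min: "\<And>q. q \<in> W \<Longrightarrow> ?d q \<ge> int (N * ?c * ?c) \<Longrightarrow>
        nat (\<Sum>k\<in>UNIV. \<bar>p $ k - x $ k\<bar>) \<le> nat (\<Sum>k\<in>UNIV. \<bar>q $ k - x $ k\<bar>)" by blast
    have d_exch: "?d (p - axis i 1 + axis j 1) = ?d p - of_bool (i \<in> X) + of_bool (j \<in> X)" for i j
    proof -
      have "(\<Sum>k\<in>X. axis l 1 $ k) = (of_bool (l \<in> X) :: int)" for l
        by (simp add: axis_nth sum.If_cases)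
      moreover have "?d (p - axis i 1 + axis j 1) = ?d p - (\<Sum>k\<in>X. axis i 1 $ k) + (\<Sum>k\<in>X. axis j 1 $ k)"
        by (simp add: sum.distrib sum_subtractf)
      ultimately show ?thesis by simp
    qed
    have no_exch: "i \<in> X \<and> j \<notin> X" if "p $ i > x $ i" "p $ j < x $ j" "p - axis i 1 + axis j 1 \<in> W" for i j
    proof (rule ccontr)
      assume "\<not> ?thesis"
      then have "?d (p - axis i 1 + axis j 1) \<ge> ?d p" unfolding d_exch by auto
      then show False
        using min[OF that(3)] p(2) exchange_closer[OF that(1,2)] by linarith
    qed
    have up: "i \<in> X" if "p $ i > x $ i" for i
      using W p(1) that no_exch[OF that] unfolding weak_exchange_def by blast
    have down: "j \<notin> X" if j: "p $ j < x $ j" for j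
    proof -
      obtain l where l: "x $ l < p $ l" "p + axis j 1 - axis l 1 \<in> W"
        using W p(1) j unfolding weak_exchange_def by blast
      then show ?thesis using no_exch[OF l(1) j] by (simp add: algebra_simps)
    qed
    have "\<exists>i\<in>X. p $ i - x $ i \<ge> int N * int ?c"
    proof (rule ccontr)
      assume "\<not> ?thesis"
      then have "?d p \<le> of_nat (card X) * (int N * int ?c - 1)"
        by (intro sum_bounded_above) force
      also have "\<dots> \<le> int ?c * (int N * int ?c - 1)"
      proof (rule mult_right_mono)
        show "int (card X) \<le> int ?c" by (simp add: card_mono)
        have "N * ?c \<ge> 1" using \<open>N > 0\<close> by (simp add: Suc_le_eq)
        then show "0 \<le> int N * int ?c - 1" by (metis diff_ge_0_iff_ge of_nat_1 of_nat_le_iff of_nat_mult)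
      qed
      also have "\<dots> < int (N * ?c * ?c)" by (simp add: algebra_simps)
      finally show False using p(2) by simp
    qed
    then obtain i where i: "i \<in> X" "p $ i - x $ i \<ge> int N * int ?c" by blast
    obtain j where "p $ j < x $ j" "\<forall>k\<le>N. x + int k *s (axis i 1 - axis j 1) \<in> W"
      using weak_exchange_large_coordinate[OF W p(1) sum0 \<open>N > 0\<close> i(2)] by blast
    then show ?thesis using down i(1) by (intro bexI[of _ "(i, j)"]) auto
  qed
  have step': "?P N" for N
    using step[OF zero_less_Suc, of N] by (meson le_SucI)
  \<comment> \<open>The pair found for \<open>N\<close> depends on \<open>N\<close>; longer moves
    contain shorter ones, so one of the finitely many pairs serves all \<open>N\<close>.\<close>
  have "\<exists>a\<in>{(i, j). i \<in> X \<and> j \<notin> X}. \<forall>N. \<forall>k\<le>N. x + int k *s (axis (fst a) 1 - axis (snd a) 1) \<in> W"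
    by (rule finite_uniform_witness[OF _ step']) auto
  then obtain i j where "i \<in> X" "j \<notin> X" "\<And>N k. k \<le> N \<Longrightarrow> x + int k *s (axis i 1 - axis j 1) \<in> W" by auto
  then show ?thesis by blast
qed

definition exchange_arcs :: "(int ^ 'm) set \<Rightarrow> int ^ 'm \<Rightarrow> ('m \<times> 'm) set" where
  "exchange_arcs W x = {(i, j). \<forall>k::nat. x + int k *s (axis i 1 - axis j 1) \<in> W}"

lemma weak_exchange_asymptotic_cone:
  fixes W :: "(int ^ 'm) set" and d :: "real ^ 'm"
  assumes W: "weak_exchange W" "x \<in> W"
    and sum0: "\<And>w. w \<in> W \<Longrightarrow> (\<Sum>k\<in>UNIV. w $ k) = 0"
    and d0: "(\<Sum>k\<in>UNIV. d $ k) = 0"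
    and near: "\<And>K :: nat. \<exists>p\<in>W. \<forall>k. \<bar>real_of_int (p $ k - x $ k) - real K * d $ k\<bar> \<le> c"
  shows "d \<in> convex_cone hull ((\<lambda>a. axis (fst a) 1 - axis (snd a) 1) ` exchange_arcs W x)"
proof (rule ccontr)
  let ?A = "exchange_arcs W x"
  let ?K = "convex_cone hull ((\<lambda>a. axis (fst a) 1 - axis (snd a) 1 :: real ^ 'm) ` ?A)"
  assume "d \<notin> ?K"
  moreover have "closed ?K" by (intro closed_convex_cone_hull finite_imageI) simp
  ultimately obtain a b where ab: "a \<bullet> d < b" "\<And>y. y \<in> ?K \<Longrightarrow> b < a \<bullet> y"
    using separating_hyperplane_closed_point[of ?K d] convex_convex_cone_hull by blast
  have b: "b < 0" using ab(2)[of 0] by (simp add: convex_cone_hull_contains_0)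
  have a_nonneg: "a \<bullet> y \<ge> 0" if "y \<in> ?K" for y
  proof (rule ccontr)
    assume "\<not> a \<bullet> y \<ge> 0"
    then have t: "a \<bullet> ((b / (a \<bullet> y)) *\<^sub>R y) = b" "b / (a \<bullet> y) \<ge> 0"
      using b by (simp_all add: divide_nonpos_neg)
    show False using ab(2)[OF convex_cone_hull_mul[OF that t(2)]] t(1) by simp
  qed
  have mono: "a $ i \<ge> a $ j" if "(i, j) \<in> ?A" for i j
  proof -
    have "axis i 1 - axis j 1 \<in> ?K" using that by (force intro: hull_inc)
    from a_nonneg[OF this] show ?thesis by (simp add: inner_diff_right inner_axis)
  qed
  \<comment> \<open>\<open>w\<close> is \<open>a\<close> reversed and shifted to be nonnegative; as
    \<open>d\<close> sums to 0, the shift does not affect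
    \<open>d \<bullet> w = - (a \<bullet> d)\<close>, which is positive. Some level set
    \<open>X\<close> of \<open>w\<close> then has positive total in \<open>d\<close>, while
    \<open>a\<close> is monotone along arcs, so no arc \<open>(i, j)\<close> has \<open>i\<close> in
    \<open>X\<close> and \<open>j\<close> outside.\<close>
  define s where "s = (\<Sum>k\<in>UNIV. \<bar>a $ k\<bar>)"
  define w where "w = (\<chi> k. s - a $ k)"
  have "w $ k \<ge> 0" for k
    using member_le_sum[of k UNIV "\<lambda>k. \<bar>a $ k\<bar>"] by (simp add: w_def s_def)
  have "d \<bullet> w = - (a \<bullet> d)"
    using d0 by (simp add: inner_vec_def w_def right_diff_distrib sum_subtractf mult.commute flip: sum_distrib_left)
  then have "w \<notin> {v. d \<bullet> v \<le> 0}" using ab(1) b by simp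
  then obtain t where t: "t \<ge> 0" "d \<bullet> (\<chi> k. if w $ k > t then 1 else 0) > 0"
    using mem_convex_cone_by_level_sets[OF convex_cone_halfspace_le, of w d] \<open>\<And>k. w $ k \<ge> 0\<close>
    by (force simp: not_le)
  define X where "X = {k. w $ k > t}"
  have dX: "(\<Sum>k\<in>X. d $ k) > 0"
    using t(2) by (simp add: inner_vec_def X_def if_distrib sum.If_cases cong: if_cong)
  have "\<exists>p\<in>W. (\<Sum>k\<in>X. p $ k - x $ k) \<ge> int N" for N :: nat
  proof -
    \<comment> \<open>The term \<open>real (card X) * c\<close> absorbs the approximation errors of
      the coordinates in \<open>X\<close>.\<close>
    obtain K :: nat where K: "real K * (\<Sum>k\<in>X. d $ k) > real N + real (card X) * c"
      using reals_Archimedean3[OF dX] by blast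
    obtain p where p: "p \<in> W" "\<And>k. \<bar>real_of_int (p $ k - x $ k) - real K * d $ k\<bar> \<le> c" using near by blast
    have "(\<Sum>k\<in>X. real K * d $ k - c) \<le> (\<Sum>k\<in>X. real_of_int (p $ k - x $ k))"
    proof (rule sum_mono)
      show "real K * d $ k - c \<le> real_of_int (p $ k - x $ k)" for k
        using p(2)[of k] by linarith
    qed
    also have "(\<Sum>k\<in>X. real K * d $ k - c) = real K * (\<Sum>k\<in>X. d $ k) - real (card X) * c"
      by (simp add: sum_subtractf sum_distrib_left)
    finally have "real N < real_of_int (\<Sum>k\<in>X. p $ k - x $ k)" using K by simp
    then have "int N \<le> (\<Sum>k\<in>X. p $ k - x $ k)" by linarith
    with p(1) show ?thesis by blast
  qed
  from weak_exchange_unbounded_set[OF W sum0 this]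
  obtain i j where ij: "i \<in> X" "j \<notin> X" "(i, j) \<in> ?A" by (auto simp: exchange_arcs_def)
  then show False using mono[OF ij(3)] by (simp add: X_def w_def)
qed

section \<open>Integral flow cones\<close>

definition int_cone :: "'i set \<Rightarrow> ('i \<Rightarrow> int ^ 'n) \<Rightarrow> (int ^ 'n) set" where
  "int_cone A g = {\<Sum>a\<in>A. f a *s g a | f. \<forall>a. 0 \<le> f a}"

lemma int_coneI: "(\<And>a. 0 \<le> f a) \<Longrightarrow> (\<Sum>a\<in>A. f a *s g a) \<in> int_cone A g"
  by (auto simp: int_cone_def)

lemma int_cone_0: "0 \<in> int_cone A g"
proof -
  have "(\<Sum>a\<in>A. 0 *s g a) \<in> int_cone A g" by (rule int_coneI) simp
  then show ?thesis by (simp add: vec_eq_iff)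
qed

lemma int_cone_add: "x \<in> int_cone A g \<Longrightarrow> y \<in> int_cone A g \<Longrightarrow> x + y \<in> int_cone A g"
proof -
  assume "x \<in> int_cone A g" "y \<in> int_cone A g"
  then obtain f f' where "\<forall>a. 0 \<le> f a" "\<forall>a. 0 \<le> f' a" "x = (\<Sum>a\<in>A. f a *s g a)" "y = (\<Sum>a\<in>A. f' a *s g a)"
    by (auto simp: int_cone_def)
  then have "x + y = (\<Sum>a\<in>A. (f a + f' a) *s g a)" "\<forall>a. 0 \<le> f a + f' a"
    by (simp_all add: vec.scale_left_distrib sum.distrib)
  then show "x + y \<in> int_cone A g" using int_coneI[of "\<lambda>a. f a + f' a" g A] by metis
qed

definition exch_arc :: "'m \<times> 'm \<Rightarrow> int ^ 'm" where
  "exch_arc a = axis (fst a) 1 - axis (snd a) 1"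

text \<open>A unit of positive excess can be pushed along arcs of the flow \<open>h\<close>, consuming \<open>h\<close>, until it meets
  a deficit.\<close>

lemma conformal_path:
  fixes A :: "('m::finite \<times> 'm) set" and h :: "'m \<times> 'm \<Rightarrow> int"
  assumes "(\<Sum>a\<in>A. h a *s exch_arc a) $ i > 0"
  shows "\<exists>j p. (\<Sum>a\<in>A. h a *s exch_arc a) $ j < 0 \<and> (\<forall>a. 0 \<le> p a \<and> p a \<le> h a \<or> h a \<le> p a \<and> p a \<le> 0) \<and>
    (\<Sum>a\<in>A. p a *s exch_arc a) = axis i 1 - axis j 1"
  using assms
proof (induction "nat (\<Sum>a\<in>A. \<bar>h a\<bar>)" arbitrary: h i rule: less_induct)
  case less
  have finA: "finite A" by simp
  have "\<exists>a\<in>A. h a * exch_arc a $ i > 0"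
  proof (rule ccontr)
    assume "\<not> ?thesis"
    then have "(\<Sum>a\<in>A. h a * exch_arc a $ i) \<le> 0" by (intro sum_nonpos) force
    with less.prems show False by simp
  qed
  then obtain a where a: "a \<in> A" "h a * exch_arc a $ i > 0" by blast
  \<comment> \<open>Arc \<open>a\<close> contributes to the excess at \<open>i\<close>; removing one
    signed unit \<open>s\<close> from it passes the excess on to its other end
    \<open>v\<close>.\<close>
  define s where "s = sgn (h a)"
  define v where "v = (if fst a = i then snd a else fst a)"
  have a_cases: "fst a = i \<and> snd a \<noteq> i \<and> h a > 0 \<or> snd a = i \<and> fst a \<noteq> i \<and> h a < 0"
    using a(2) by (auto simp: exch_arc_def axis_nth zero_less_mult_iff split: if_splits)
  have s_arc: "s *s exch_arc a = axis i 1 - axis v 1" "v \<noteq> i" and s: "\<bar>h a - s\<bar> = \<bar>h a\<bar> - 1"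
    using a_cases by (auto simp: s_def v_def exch_arc_def vec_eq_iff)
  define h' where "h' = h(a := h a - s)"
  have split: "(\<Sum>b\<in>A. f b *s exch_arc b) = f a *s exch_arc a + (\<Sum>b\<in>A - {a}. f b *s exch_arc b)" for f
    by (rule sum.remove[OF finA a(1)])
  have h': "(\<Sum>b\<in>A. h' b *s exch_arc b) = (\<Sum>b\<in>A. h b *s exch_arc b) - (axis i 1 - axis v 1)"
  proof -
    have "(\<Sum>b\<in>A - {a}. h' b *s exch_arc b) = (\<Sum>b\<in>A - {a}. h b *s exch_arc b)"
      by (intro sum.cong) (auto simp: h'_def)
    then show ?thesis
      unfolding split[of h'] split[of h] s_arc(1)[symmetric] by (simp add: h'_def vec.scale_left_diff_distrib)
  qed
  have "(\<Sum>b\<in>A. \<bar>h' b\<bar>) < (\<Sum>b\<in>A. \<bar>h b\<bar>)"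
  proof (rule sum_strict_mono_ex1[OF finA])
    show "\<forall>b\<in>A. \<bar>h' b\<bar> \<le> \<bar>h b\<bar>" using s by (simp add: h'_def)
    show "\<exists>b\<in>A. \<bar>h' b\<bar> < \<bar>h b\<bar>" using s a(1) by (intro bexI[of _ a]) (simp_all add: h'_def)
  qed
  moreover have "0 \<le> (\<Sum>b\<in>A. \<bar>h' b\<bar>)" by (simp add: sum_nonneg)
  ultimately have smaller: "nat (\<Sum>b\<in>A. \<bar>h' b\<bar>) < nat (\<Sum>b\<in>A. \<bar>h b\<bar>)" by linarith
  have conf: "0 \<le> p b \<and> p b \<le> h b \<or> h b \<le> p b \<and> p b \<le> 0"
    if "\<forall>b. 0 \<le> q b \<and> q b \<le> h' b \<or> h' b \<le> q b \<and> q b \<le> 0" "p = q(a := q a + s)" for p q b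
  proof (cases "b = a")
    case True
    have "0 \<le> q a \<and> q a \<le> h a - s \<or> h a - s \<le> q a \<and> q a \<le> 0"
      using that(1) unfolding h'_def by (metis fun_upd_same)
    moreover have "s = 1 \<and> h a > 0 \<or> s = -1 \<and> h a < 0" using a_cases by (auto simp: s_def)
    ultimately show ?thesis using True that(2) by auto
  next
    case False
    then show ?thesis using that by (metis fun_upd_other h'_def)
  qed
  have flow: "(\<Sum>b\<in>A. p b *s exch_arc b) = (\<Sum>b\<in>A. q b *s exch_arc b) + (axis i 1 - axis v 1)"
    if "p = q(a := q a + s)" for p q
  proof -
    have "(\<Sum>b\<in>A - {a}. p b *s exch_arc b) = (\<Sum>b\<in>A - {a}. q b *s exch_arc b)"
      by (intro sum.cong) (auto simp: that)
    then show ?thesis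
      unfolding split[of p] split[of q] s_arc(1)[symmetric] by (simp add: that vec.scale_left_distrib)
  qed
  show ?case
  proof (cases "(\<Sum>b\<in>A. h b *s exch_arc b) $ v < 0")
    case True
    have "\<forall>b. 0 \<le> (0::int) \<and> 0 \<le> h' b \<or> h' b \<le> 0 \<and> (0::int) \<le> 0" by linarith
    then have "\<forall>b. 0 \<le> ((\<lambda>_. 0)(a := 0 + s)) b \<and> ((\<lambda>_. 0)(a := 0 + s)) b \<le> h b
        \<or> h b \<le> ((\<lambda>_. 0)(a := 0 + s)) b \<and> ((\<lambda>_. 0)(a := 0 + s)) b \<le> 0"
      using conf[of "\<lambda>_. 0"] by blast
    moreover have "(\<Sum>b\<in>A. ((\<lambda>_. 0)(a := 0 + s)) b *s exch_arc b) = axis i 1 - axis v 1"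
      using flow[OF refl, of "\<lambda>_. 0"] by simp
    ultimately show ?thesis using True by blast
  next
    case False
    then have "(\<Sum>b\<in>A. h' b *s exch_arc b) $ v > 0"
      using s_arc(2) by (simp only: h' vector_minus_component axis_nth) auto
    from less.hyps[OF smaller this] obtain j q where
      j: "(\<Sum>b\<in>A. h' b *s exch_arc b) $ j < 0" and
      q: "\<forall>b. 0 \<le> q b \<and> q b \<le> h' b \<or> h' b \<le> q b \<and> q b \<le> 0"
      and q_flow: "(\<Sum>b\<in>A. q b *s exch_arc b) = axis v 1 - axis j 1" by blast
    \<comment> \<open>The only coordinate that loses a unit is \<open>i\<close>, which had positive
      excess; so a deficit of the reduced flow is already a deficit of \<open>h\<close>.\<close>
    have "(\<Sum>b\<in>A. h b *s exch_arc b) $ j < 0"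
    proof -
      have "(\<Sum>b\<in>A. h' b *s exch_arc b) $ j = (\<Sum>b\<in>A. h b *s exch_arc b) $ j - of_bool (j = i) + of_bool (j = v)"
        by (simp only: h' vector_minus_component axis_nth) auto
      with j less.prems False s_arc(2) show ?thesis by (cases "j = i"; cases "j = v") simp_all
    qed
    moreover have "(\<Sum>b\<in>A. (q(a := q a + s)) b *s exch_arc b) = axis i 1 - axis j 1"
      using flow[OF refl, of q] q_flow by (simp add: algebra_simps)
    ultimately show ?thesis using conf[OF q refl] by blast
  qed
qed

text \<open>The path is taken in the difference of two flows representing \<open>x\<close> and
  \<open>y\<close>. Conformality means that it only consumes the surplus of one flow over the other,
  so both corrected flows stay nonnegative.\<close>

lemma M_convex_int_cone_arcs: "M_convex (int_cone A exch_arc)"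
  unfolding M_convex_def
proof (intro conjI ballI allI impI)
  show "int_cone A exch_arc \<noteq> {}" using int_cone_0 by blast
  fix x y :: "int ^ 'a" and i
  assume "x \<in> int_cone A exch_arc" "y \<in> int_cone A exch_arc" and i: "x $ i > y $ i"
  then obtain f g where f: "\<forall>a. 0 \<le> f a" "x = (\<Sum>a\<in>A. f a *s exch_arc a)"
    and g: "\<forall>a. 0 \<le> g a" "y = (\<Sum>a\<in>A. g a *s exch_arc a)"
    by (auto simp: int_cone_def)
  have lin: "(\<Sum>a\<in>A. (u a - w a) *s exch_arc a) = (\<Sum>a\<in>A. u a *s exch_arc a) - (\<Sum>a\<in>A. w a *s exch_arc a)" for u w
    by (simp add: vec.scale_left_diff_distrib sum_subtractf)
  have diff: "(\<Sum>a\<in>A. (f a - g a) *s exch_arc a) = x - y" by (simp only: lin f g)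
  have "(\<Sum>a\<in>A. (f a - g a) *s exch_arc a) $ i > 0" using i unfolding diff by simp
  from conformal_path[OF this] obtain j p where j: "(x - y) $ j < 0"
    and p: "\<forall>a. 0 \<le> p a \<and> p a \<le> f a - g a \<or> f a - g a \<le> p a \<and> p a \<le> 0"
    and flow: "(\<Sum>a\<in>A. p a *s exch_arc a) = axis i 1 - axis j 1"
    unfolding diff by blast
  have nonneg: "0 \<le> f a - p a" "0 \<le> g a - - p a" for a
    using p[rule_format, of a] f(1)[rule_format, of a] g(1)[rule_format, of a] by linarith+
  have "(\<Sum>a\<in>A. (f a - p a) *s exch_arc a) \<in> int_cone A exch_arc"
    by (rule int_coneI) (rule nonneg)
  moreover have "(\<Sum>a\<in>A. (g a - - p a) *s exch_arc a) \<in> int_cone A exch_arc"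
    by (rule int_coneI) (rule nonneg)
  moreover have "(\<Sum>a\<in>A. (f a - p a) *s exch_arc a) = x - axis i 1 + axis j 1"
    unfolding lin flow f(2)[symmetric] by (simp add: algebra_simps)
  moreover have "(\<Sum>a\<in>A. (g a - - p a) *s exch_arc a) = y + axis i 1 - axis j 1"
  proof -
    have "(\<Sum>a\<in>A. - p a *s exch_arc a) = - (\<Sum>a\<in>A. p a *s exch_arc a)"
      by (simp add: vec_eq_iff sum_negf)
    then show ?thesis unfolding lin g(2)[symmetric] flow by simp
  qed
  ultimately show "\<exists>j. x $ j < y $ j \<and> x - axis i 1 + axis j 1 \<in> int_cone A exch_arc \<and> y + axis i 1 - axis j 1 \<in> int_cone A exch_arc"
    using j by auto
qed

lemma sum_unlift_linear: "sum_unlift (\<Sum>a\<in>A. f a *s g a) = (\<Sum>a\<in>A. f a *s sum_unlift (g a))"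
  by (simp add: vec_eq_iff)

text \<open>Forgetting \<open>None\<close> turns an exchange with it into the first alternative of
  the M-natural axiom.\<close>

lemma Mnat_convex_sum_unlift:
  fixes W :: "(int ^ 'n::finite option) set"
  assumes "M_convex W"
  shows "Mnat_convex (sum_unlift ` W)"
  unfolding Mnat_convex_def
proof (intro conjI ballI allI impI)
  show "sum_unlift ` W \<noteq> {}" using assms by (simp add: M_convex_def)
  fix x y :: "int ^ 'n" and i assume "x \<in> sum_unlift ` W" "y \<in> sum_unlift ` W" and i: "x $ i > y $ i"
  then obtain X Y where X: "X \<in> W" "x = sum_unlift X" and Y: "Y \<in> W" "y = sum_unlift Y" by blast
  obtain j where j: "X $ j < Y $ j" "X - axis (Some i) 1 + axis j 1 \<in> W" "Y + axis (Some i) 1 - axis j 1 \<in> W"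
    using assms X Y i unfolding M_convex_def by (metis sum_unlift_nth)
  have ax: "sum_unlift (U + V) = sum_unlift U + sum_unlift V" "sum_unlift (U - V) = sum_unlift U - sum_unlift V"
    "sum_unlift (axis (Some k) 1) = axis k 1" "sum_unlift (axis None 1) = 0" for U V and k :: 'n
    by (simp_all add: vec_eq_iff axis_nth)
  have mem: "sum_unlift (X - axis (Some i) 1 + axis j 1) \<in> sum_unlift ` W"
    "sum_unlift (Y + axis (Some i) 1 - axis j 1) \<in> sum_unlift ` W"
    using j by blast+
  show "(x - axis i 1 \<in> sum_unlift ` W \<and> y + axis i 1 \<in> sum_unlift ` W) \<or>
    (\<exists>j. x $ j < y $ j \<and> x - axis i 1 + axis j 1 \<in> sum_unlift ` W \<and> y + axis i 1 - axis j 1 \<in> sum_unlift ` W)"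
  proof (cases j)
    case None
    then show ?thesis using mem by (simp add: X Y ax)
  next
    case (Some k)
    then have "x $ k < y $ k" using j(1) by (simp add: X Y)
    then show ?thesis using mem Some by (auto simp: X Y ax)
  qed
qed

text \<open>Dirichlet approximation of a real relation \<open>w\<close> yields an integral relation supported on its support.\<close>

lemma integral_relation:
  fixes c :: "'i \<Rightarrow> int ^ 'n" and w :: "'i \<Rightarrow> real"
  assumes I: "finite I" and nonneg: "\<And>i. i \<in> I \<Longrightarrow> 0 \<le> w i"
    and rel: "(\<Sum>i\<in>I. w i *\<^sub>R real_vec (c i)) = 0" and "i0 \<in> I" "w i0 > 0"
  obtains l :: "'i \<Rightarrow> int" where "\<forall>i. 0 \<le> l i" "\<forall>i\<in>I. w i = 0 \<longrightarrow> l i = 0" "l i0 > 0"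
    "(\<Sum>i\<in>I. l i *s c i) = 0"
proof -
  \<comment> \<open>The normalisation gives \<open>i0\<close> the coefficient 1, so its
    approximation \<open>l i0\<close> is the positive denominator \<open>q\<close>. Errors below 1
    preserve zeros and nonnegativity.\<close>
  define \<mu> where "\<mu> i = w i / w i0" for i
  obtain e where e: "bij_betw e {0..<card I} I" using ex_bij_betw_nat_finite[OF I] by blast
  \<comment> \<open>\<open>N\<close> exceeds the sum of all absolute entries, so errors below
    \<open>1 / N\<close> change each coordinate of the relation by less than 1, and an integer of
    absolute value below 1 is 0.\<close>
  define N where "N = Suc (nat (\<Sum>i\<in>I. \<Sum>k\<in>UNIV. \<bar>c i $ k\<bar>))"
  have "0 < N" by (simp add: N_def)
  from Dirichlet_approx_simult[OF this, of "card I" "\<lambda>m. \<mu> (e m)"]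
  obtain q p where q: "0 < q" and p: "\<And>m. m < card I \<Longrightarrow> \<bar>real_of_int q * \<mu> (e m) - real_of_int (p m)\<bar> < 1 / real N"
    by metis
  define l where "l i = (if i \<in> I then p (inv_into {0..<card I} e i) else 0)" for i
  have close: "\<bar>real_of_int q * \<mu> i - real_of_int (l i)\<bar> < 1 / real N" if "i \<in> I" for i
  proof -
    let ?m = "inv_into {0..<card I} e i"
    have i: "i \<in> e ` {0..<card I}" using e that by (simp add: bij_betw_def)
    have "e ?m = i" "?m < card I"
      using f_inv_into_f[OF i] inv_into_into[OF i] by simp_all
    then show ?thesis using p[of ?m] that by (simp add: l_def)
  qed
  have close1: "\<bar>real_of_int q * \<mu> i - real_of_int (l i)\<bar> < 1" if "i \<in> I" for i
  proof -
    have "1 / real N \<le> 1" by (simp add: N_def)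
    then show ?thesis using close[OF that] by linarith
  qed
  have "0 \<le> l i" for i
  proof (cases "i \<in> I")
    case True
    have "0 \<le> real_of_int q * \<mu> i"
      using q nonneg[OF True] \<open>w i0 > 0\<close> by (simp add: \<mu>_def)
    with close1[OF True] have "real_of_int (l i) > - 1" by linarith
    then show ?thesis by linarith
  qed (simp add: l_def)
  moreover have "l i = 0" if "i \<in> I" "w i = 0" for i
    using close1[OF that(1)] that(2) by (simp add: \<mu>_def)
  moreover have "l i0 > 0"
  proof -
    have "\<mu> i0 = 1" using \<open>w i0 > 0\<close> by (simp add: \<mu>_def)
    with close1[OF \<open>i0 \<in> I\<close>] q show ?thesis by simp
  qed
  moreover have "(\<Sum>i\<in>I. l i *s c i) = 0"
  proof -
    have "(\<Sum>i\<in>I. l i * c i $ k) = 0" for k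
    proof -
      have "(\<Sum>i\<in>I. w i *\<^sub>R real_vec (c i)) $ k = 0" using rel by simp
      then have "(\<Sum>i\<in>I. w i * real_of_int (c i $ k)) = 0" by simp
      moreover have "(\<Sum>i\<in>I. real_of_int q * \<mu> i * real_of_int (c i $ k)) = real_of_int q / w i0 * (\<Sum>i\<in>I. w i * real_of_int (c i $ k))"
        unfolding sum_distrib_left by (intro sum.cong) (simp_all add: \<mu>_def)
      ultimately have "real_of_int (\<Sum>i\<in>I. l i * c i $ k) = - (\<Sum>i\<in>I. (real_of_int q * \<mu> i - real_of_int (l i)) * real_of_int (c i $ k))"
        by (simp add: left_diff_distrib sum_subtractf)
      then have "\<bar>real_of_int (\<Sum>i\<in>I. l i * c i $ k)\<bar> \<le> (\<Sum>i\<in>I. \<bar>(real_of_int q * \<mu> i - real_of_int (l i)) * real_of_int (c i $ k)\<bar>)"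
        using sum_abs[of "\<lambda>i. (real_of_int q * \<mu> i - real_of_int (l i)) * real_of_int (c i $ k)" I] by simp
      also have "\<dots> \<le> (\<Sum>i\<in>I. 1 / real N * real_of_int (\<Sum>k\<in>UNIV. \<bar>c i $ k\<bar>))"
      proof (rule sum_mono)
        fix i assume i: "i \<in> I"
        have "\<bar>c i $ k\<bar> \<le> (\<Sum>k\<in>UNIV. \<bar>c i $ k\<bar>)" by (rule member_le_sum) simp_all
        then have "\<bar>real_of_int (c i $ k)\<bar> \<le> real_of_int (\<Sum>k\<in>UNIV. \<bar>c i $ k\<bar>)" by linarith
        then show "\<bar>(real_of_int q * \<mu> i - real_of_int (l i)) * real_of_int (c i $ k)\<bar> \<le> 1 / real N * real_of_int (\<Sum>k\<in>UNIV. \<bar>c i $ k\<bar>)"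
          unfolding abs_mult using close[OF i] by (intro mult_mono) simp_all
      qed
      also have "\<dots> = real_of_int (\<Sum>i\<in>I. \<Sum>k\<in>UNIV. \<bar>c i $ k\<bar>) / real N"
        by (simp add: sum_divide_distrib)
      also have "\<dots> < 1"
      proof -
        have "(\<Sum>i\<in>I. \<Sum>k\<in>UNIV. \<bar>c i $ k\<bar>) < int N" by (simp add: N_def sum_nonneg)
        then have "real_of_int (\<Sum>i\<in>I. \<Sum>k\<in>UNIV. \<bar>c i $ k\<bar>) < real N" by linarith
        then show ?thesis by (simp add: N_def)
      qed
      finally have "\<bar>\<Sum>i\<in>I. l i * c i $ k\<bar> < 1" by linarith
      then show ?thesis by simp
    qed
    then show ?thesis by (simp add: vec_eq_iff)
  qed
  ultimately show thesis using that by blast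
qed

text \<open>Subtract the largest multiple of an integral relation that keeps all weights
  nonnegative: one weight vanishes, and the relation persists for \<open>c\<close>. The separate
  family \<open>b\<close> reads off the vector of interest, whose integral instances lie in
  \<open>K\<close> by assumption.\<close>

lemma real_relation_mem_convex_cone:
  fixes c :: "'i \<Rightarrow> int ^ 'n" and b :: "'i \<Rightarrow> int ^ 'k" and w :: "'i \<Rightarrow> real"
  assumes I: "finite I" and K: "convex_cone K"
    and int: "\<And>l. \<lbrakk>\<forall>i. 0 \<le> l i; (\<Sum>i\<in>I. l i *s c i) = 0\<rbrakk> \<Longrightarrow> real_vec (\<Sum>i\<in>I. l i *s b i) \<in> K"
    and "\<And>i. i \<in> I \<Longrightarrow> 0 \<le> w i" "(\<Sum>i\<in>I. w i *\<^sub>R real_vec (c i)) = 0"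
  shows "(\<Sum>i\<in>I. w i *\<^sub>R real_vec (b i)) \<in> K"
  using assms(4-)
proof (induction "card {i\<in>I. w i \<noteq> 0}" arbitrary: w rule: less_induct)
  case less
  show ?case
  proof (cases "\<exists>i\<in>I. w i \<noteq> 0")
    case False
    then have "(\<Sum>i\<in>I. w i *\<^sub>R real_vec (b i)) = 0" by (intro sum.neutral) simp
    then show ?thesis using convex_cone_contains_0[OF K] by simp
  next
    case True
    then obtain i0 where i0: "i0 \<in> I" "w i0 > 0" using less.prems(1) by force
    obtain l :: "'i \<Rightarrow> int" where l: "\<forall>i. 0 \<le> l i" "\<forall>i\<in>I. w i = 0 \<longrightarrow> l i = 0" "l i0 > 0"
      "(\<Sum>i\<in>I. l i *s c i) = 0"
      using integral_relation[OF I less.prems(1,2) i0] .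
    let ?J = "{i\<in>I. l i > 0}"
    define t where "t = Min ((\<lambda>i. w i / real_of_int (l i)) ` ?J)"
    have "t \<in> (\<lambda>i. w i / real_of_int (l i)) ` ?J"
      unfolding t_def using I i0 l(3) by (intro Min_in) auto
    then obtain i1 where i1: "i1 \<in> I" "l i1 > 0" "t = w i1 / real_of_int (l i1)" by auto
    have t_le: "t * real_of_int (l i) \<le> w i" if "i \<in> I" for i
    proof (cases "l i > 0")
      case True
      then have "t \<le> w i / real_of_int (l i)"
        unfolding t_def using I that by (intro Min_le) auto
      then show ?thesis using True by (simp add: pos_le_divide_eq)
    next
      case False
      with l(1) have "l i = 0" by (metis less_le)
      then show ?thesis using less.prems(1)[OF that] by simp
    qed
    have "t \<ge> 0" using i1 less.prems(1)[OF i1(1)] by simp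
    define \<mu> where "\<mu> i = w i - t * real_of_int (l i)" for i
    have real_l: "(\<Sum>i\<in>I. real_of_int (l i) *\<^sub>R real_vec (f i)) = real_vec (\<Sum>i\<in>I. l i *s f i)"
      for f :: "'i \<Rightarrow> int ^ 'z"
      by (simp add: vec_eq_iff)
    have \<mu>_sum: "(\<Sum>i\<in>I. \<mu> i *\<^sub>R real_vec (f i)) = (\<Sum>i\<in>I. w i *\<^sub>R real_vec (f i)) - t *\<^sub>R real_vec (\<Sum>i\<in>I. l i *s f i)"
      for f :: "'i \<Rightarrow> int ^ 'z"
      unfolding real_l[symmetric] by (simp add: \<mu>_def scaleR_diff_left sum_subtractf scaleR_sum_right)
    have "(\<Sum>i\<in>I. \<mu> i *\<^sub>R real_vec (b i)) \<in> K"
    proof (rule less.hyps)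
      have "{i\<in>I. \<mu> i \<noteq> 0} \<subseteq> {i\<in>I. w i \<noteq> 0} - {i1}"
        using l(2) i1 by (auto simp: \<mu>_def)
      moreover have "w i1 \<noteq> 0" using l(2) i1 by auto
      ultimately have "{i\<in>I. \<mu> i \<noteq> 0} \<subset> {i\<in>I. w i \<noteq> 0}" using i1(1) by blast
      then show "card {i\<in>I. \<mu> i \<noteq> 0} < card {i\<in>I. w i \<noteq> 0}"
        using I by (intro psubset_card_mono) simp_all
      show "0 \<le> \<mu> i" if "i \<in> I" for i using t_le[OF that] by (simp add: \<mu>_def)
      show "(\<Sum>i\<in>I. \<mu> i *\<^sub>R real_vec (c i)) = 0" by (simp only: \<mu>_sum less.prems(2) l(4)) simp
    qed
    moreover have "t *\<^sub>R real_vec (\<Sum>i\<in>I. l i *s b i) \<in> K"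
      using int[OF l(1,4)] \<open>t \<ge> 0\<close> by (rule convex_cone_scaleR[OF K, rotated])
    ultimately have "(\<Sum>i\<in>I. \<mu> i *\<^sub>R real_vec (b i)) + t *\<^sub>R real_vec (\<Sum>i\<in>I. l i *s b i) \<in> K"
      by (rule convex_cone_add[OF K])
    then show ?thesis by (simp add: \<mu>_sum)
  qed
qed

lemma convex_cone_hull_image_explicit:
  fixes f :: "'i \<Rightarrow> 'v::real_vector"
  assumes "finite A" "d \<in> convex_cone hull (f ` A)"
  shows "\<exists>w. (\<forall>a\<in>A. 0 \<le> w a) \<and> d = (\<Sum>a\<in>A. w a *\<^sub>R f a)"
proof -
  let ?C = "{\<Sum>a\<in>A. w a *\<^sub>R f a | w :: 'i \<Rightarrow> real. \<forall>a\<in>A. 0 \<le> w a}"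
  have cone: "convex_cone ?C"
    unfolding convex_cone_iff
  proof (intro conjI ballI allI impI)
    show "0 \<in> ?C" by (intro CollectI exI[of _ "\<lambda>_. 0"]) simp
    show "x + y \<in> ?C" if xy: "x \<in> ?C" "y \<in> ?C" for x y
    proof -
      obtain u v where "\<forall>a\<in>A. 0 \<le> u a" "\<forall>a\<in>A. 0 \<le> v a" "x = (\<Sum>a\<in>A. u a *\<^sub>R f a)" "y = (\<Sum>a\<in>A. v a *\<^sub>R f a)"
        using xy by auto
      then show ?thesis
        by (intro CollectI exI[of _ "\<lambda>a. u a + v a"]) (simp add: scaleR_add_left sum.distrib)
    qed
    show "c *\<^sub>R x \<in> ?C" if xc: "x \<in> ?C" "0 \<le> c" for x c
    proof -
      obtain u where "\<forall>a\<in>A. 0 \<le> u a" "x = (\<Sum>a\<in>A. u a *\<^sub>R f a)" using xc(1) by auto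
      then show ?thesis
        using xc(2) by (intro CollectI exI[of _ "\<lambda>a. c * u a"]) (simp add: scaleR_sum_right)
    qed
  qed
  have subset: "f ` A \<subseteq> ?C"
  proof clarify
    fix a assume "a \<in> A"
    have "(\<Sum>x\<in>A. (if x = a then 1 else 0) *\<^sub>R f x) = (\<Sum>x\<in>A. if x = a then f a else 0)"
      by (intro sum.cong) auto
    then show "\<exists>w. f a = (\<Sum>a\<in>A. w a *\<^sub>R f a) \<and> (\<forall>a\<in>A. 0 \<le> w a)"
      using assms(1) \<open>a \<in> A\<close> by (intro exI[of _ "\<lambda>x. if x = a then 1 else 0"]) simp
  qed
  show ?thesis using hull_minimal[of "f ` A" ?C convex_cone, OF subset cone] assms(2) by blast
qed

text \<open>Two representations of \<open>d\<close> amount to a relation between the vectors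
  \<open>g a\<close> and \<open>- h b\<close>. Its integral instances are pairs of integral
  combinations with a common value, which thus lies in both integer cones; only the \<open>g\<close>
  half is read off, and its real sum is \<open>d\<close>.\<close>

lemma convex_cone_hull_Int_integral:
  fixes g :: "'i \<Rightarrow> int ^ 'n" and h :: "'j \<Rightarrow> int ^ 'n"
  assumes A: "finite A" and B: "finite B"
    and d: "d \<in> convex_cone hull ((\<lambda>a. real_vec (g a)) ` A)" "d \<in> convex_cone hull ((\<lambda>b. real_vec (h b)) ` B)"
  shows "d \<in> convex hull (real_vec ` (int_cone A g \<inter> int_cone B h))" (is "_ \<in> ?K")
proof -
  have K: "convex_cone ?K"
    by (rule convex_cone_hull_int_monoid) (auto simp: int_cone_0 int_cone_add)
  obtain u where u: "\<forall>a\<in>A. 0 \<le> u a" "d = (\<Sum>a\<in>A. u a *\<^sub>R real_vec (g a))"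
    using convex_cone_hull_image_explicit[OF A d(1)] by blast
  obtain v where v: "\<forall>b\<in>B. 0 \<le> v b" "d = (\<Sum>b\<in>B. v b *\<^sub>R real_vec (h b))"
    using convex_cone_hull_image_explicit[OF B d(2)] by blast
  let ?c = "case_sum g (\<lambda>b. - h b)" and ?b = "case_sum g (\<lambda>b. 0)"
  have neg: "real_vec (- x) = - real_vec x" for x :: "int ^ 'n" by (simp add: vec_eq_iff)
  have "(\<Sum>i\<in>A <+> B. case_sum u v i *\<^sub>R real_vec (?b i)) \<in> ?K"
  proof (rule real_relation_mem_convex_cone[where c = ?c])
    show "finite (A <+> B)" using A B by simp
    show "0 \<le> case_sum u v i" if "i \<in> A <+> B" for i using that u(1) v(1) by auto
    show "(\<Sum>i\<in>A <+> B. case_sum u v i *\<^sub>R real_vec (?c i)) = 0"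
      using u(2) v(2) by (simp add: sum.Plus[OF A B] neg sum_negf)
    fix l :: "'i + 'j \<Rightarrow> int"
    assume l: "\<forall>i. 0 \<le> l i" "(\<Sum>i\<in>A <+> B. l i *s ?c i) = 0"
    have "(\<Sum>a\<in>A. l (Inl a) *s g a) = (\<Sum>b\<in>B. l (Inr b) *s h b)"
      using l(2) by (simp add: sum.Plus[OF A B] vec.scale_minus_right sum_negf)
    moreover have "(\<Sum>a\<in>A. l (Inl a) *s g a) \<in> int_cone A g" "(\<Sum>b\<in>B. l (Inr b) *s h b) \<in> int_cone B h"
      using l(1) int_coneI[of "\<lambda>a. l (Inl a)" g A] int_coneI[of "\<lambda>b. l (Inr b)" h B] by blast+
    ultimately have "(\<Sum>a\<in>A. l (Inl a) *s g a) \<in> int_cone A g \<inter> int_cone B h" by simp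
    moreover have "(\<Sum>i\<in>A <+> B. l i *s ?b i) = (\<Sum>a\<in>A. l (Inl a) *s g a)"
      by (simp add: sum.Plus[OF A B])
    ultimately show "real_vec (\<Sum>i\<in>A <+> B. l i *s ?b i) \<in> ?K" by (simp only: hull_inc imageI)
  qed (rule K)
  also have "(\<Sum>i\<in>A <+> B. case_sum u v i *\<^sub>R real_vec (?b i)) = d"
    by (simp add: sum.Plus[OF A B] u(2))
  finally show ?thesis .
qed

section \<open>Decomposition of M-convex classes\<close>

text \<open>An arc between \<open>None\<close> and another coordinate unlifts to plus or minus a
  unit vector, the arcs within the original coordinates to differences of two.\<close>

definition Mnat_recession :: "(int ^ 'n) set \<Rightarrow> int ^ 'n \<Rightarrow> (int ^ 'n) set" where
  "Mnat_recession T x =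
    int_cone (exchange_arcs (sum_lift ` T) (sum_lift x)) (\<lambda>a. sum_unlift (exch_arc a))"

lemma Mnat_convex_Mnat_recession: "Mnat_convex (Mnat_recession T x)"
proof -
  let ?A = "exchange_arcs (sum_lift ` T) (sum_lift x)"
  have "Mnat_recession T x = sum_unlift ` int_cone ?A exch_arc"
    unfolding Mnat_recession_def int_cone_def sum_unlift_linear[symmetric] by blast
  then show ?thesis using Mnat_convex_sum_unlift[OF M_convex_int_cone_arcs, of ?A] by simp
qed

lemma Mnat_recession_0: "0 \<in> Mnat_recession T x"
  by (simp add: Mnat_recession_def int_cone_0)

lemma convex_cone_sum:
  assumes "convex_cone K" "\<And>a. a \<in> A \<Longrightarrow> f a \<in> K"
  shows "sum f A \<in> K"
  using assms(2)
  by (induction A rule: infinite_finite_induct)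
    (simp_all add: convex_cone_contains_0[OF assms(1)] convex_cone_add[OF assms(1)])

text \<open>Directions are tested from one base point because, for an intersection, only the hull of
  \<open>T \<inter> U\<close> is assumed to be a polyhedron, not the hull of \<open>T\<close>.
  Midpoints of two rays of double speed give sums.\<close>

lemma convex_cone_recession_at:
  fixes P :: "'a::real_vector set"
  assumes "convex P" "x \<in> P"
  shows "convex_cone {d. \<forall>t\<ge>0. x + t *\<^sub>R d \<in> P}" (is "convex_cone ?D")
  unfolding convex_cone_iff
proof (intro conjI ballI allI impI)
  show "0 \<in> ?D" using assms(2) by simp
  show "d + e \<in> ?D" if "d \<in> ?D" "e \<in> ?D" for d e
  proof (intro CollectI allI impI)
    fix t :: real assume "t \<ge> 0"
    then have "x + (2 * t) *\<^sub>R d \<in> P" "x + (2 * t) *\<^sub>R e \<in> P" using that by simp_all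
    then have "(1/2) *\<^sub>R (x + (2 * t) *\<^sub>R d) + (1/2) *\<^sub>R (x + (2 * t) *\<^sub>R e) \<in> P"
      by (intro convexD[OF assms(1)]) simp_all
    moreover have "(1/2) *\<^sub>R x + (1/2) *\<^sub>R x = x" by (simp flip: scaleR_add_left)
    ultimately show "x + t *\<^sub>R (d + e) \<in> P" by (simp add: scaleR_add_right algebra_simps)
  qed
  show "c *\<^sub>R d \<in> ?D" if "d \<in> ?D" "0 \<le> c" for d c using that by simp
qed

text \<open>Each arc gives a ray from \<open>x\<close> in the hull, and directions of such rays form
  a convex cone; so the new point lies in the hull, and being integral it lies in
  \<open>T\<close>.\<close>

lemma Mnat_recession_step:
  fixes T :: "(int ^ 'n) set"
  assumes T: "Mnat_convex T" "x \<in> T" and r: "r \<in> Mnat_recession T x"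
  shows "x + int k *s r \<in> T"
proof -
  let ?A = "exchange_arcs (sum_lift ` T) (sum_lift x)"
  let ?g = "\<lambda>a. sum_unlift (exch_arc a)"
  let ?P = "convex hull (real_vec ` T)"
  let ?D = "{d. \<forall>t\<ge>0. real_vec x + t *\<^sub>R d \<in> ?P}"
  have "real_vec x \<in> ?P" using T(2) by (simp add: hull_inc)
  then have D: "convex_cone ?D" by (intro convex_cone_recession_at) simp_all
  have g: "real_vec x + real m *\<^sub>R real_vec (?g a) \<in> ?P" if "a \<in> ?A" for a m
  proof -
    have "sum_lift x + int m *s exch_arc a \<in> sum_lift ` T"
      using that by (auto simp: exchange_arcs_def exch_arc_def)
    then obtain y where y: "y \<in> T" "sum_lift x + int m *s exch_arc a = sum_lift y" by blast
    have "x + int m *s ?g a = sum_unlift (sum_lift x + int m *s exch_arc a)" by (simp add: vec_eq_iff)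
    also have "\<dots> = y" by (simp add: y(2))
    finally have "x + int m *s ?g a = y" .
    moreover have "real_vec (x + int m *s ?g a) = real_vec x + real m *\<^sub>R real_vec (?g a)"
      by (simp add: vec_eq_iff)
    ultimately show ?thesis using y(1) by (metis hull_inc imageI)
  qed
  have gD: "real_vec (?g a) \<in> ?D" if a: "a \<in> ?A" for a
  proof (intro CollectI allI impI)
    fix t :: real assume t: "t \<ge> 0"
    obtain m :: nat where m: "t < real m" using reals_Archimedean2 by blast
    have "(1 - t / real m) *\<^sub>R real_vec x + (t / real m) *\<^sub>R (real_vec x + real m *\<^sub>R real_vec (?g a)) \<in> ?P"
      using m t g[OF a] \<open>real_vec x \<in> ?P\<close> by (intro convexD[OF convex_convex_hull]) simp_all
    moreover have "(1 - t / real m) *\<^sub>R real_vec x + (t / real m) *\<^sub>R real_vec x = real_vec x"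
      by (simp flip: scaleR_add_left)
    ultimately show "real_vec x + t *\<^sub>R real_vec (?g a) \<in> ?P"
      using m t by (simp add: scaleR_add_right add.assoc[symmetric])
  qed
  obtain f where f: "\<forall>a. 0 \<le> f a" "r = (\<Sum>a\<in>?A. f a *s ?g a)"
    using r by (auto simp: Mnat_recession_def int_cone_def)
  have "real_vec r = (\<Sum>a\<in>?A. real_of_int (f a) *\<^sub>R real_vec (?g a))"
    by (simp add: f(2) vec_eq_iff)
  also have "\<dots> \<in> ?D"
  proof (rule convex_cone_sum[OF D])
    fix a assume "a \<in> ?A"
    then show "real_of_int (f a) *\<^sub>R real_vec (?g a) \<in> ?D"
      using convex_cone_scaleR[OF D _ gD, of "real_of_int (f a)" a] f(1) by simp
  qed
  finally have "real_vec x + real k *\<^sub>R real_vec r \<in> ?P" by simp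
  also have "real_vec x + real k *\<^sub>R real_vec r = real_vec (x + int k *s r)" by (simp add: vec_eq_iff)
  finally show ?thesis by (rule Mnat_hull_integral[OF T(1)])
qed

lemma Mnat_asymptotic_direction:
  fixes T :: "(int ^ 'n) set"
  assumes T: "Mnat_convex T" "x \<in> T"
    and d: "\<And>k::nat. real_vec x + real k *\<^sub>R d \<in> convex hull (real_vec ` T)"
  shows "d \<in> convex_cone hull ((\<lambda>a. real_vec (sum_unlift (exch_arc a))) ` exchange_arcs (sum_lift ` T) (sum_lift x))"
proof -
  let ?A = "exchange_arcs (sum_lift ` T) (sum_lift x)"
  define D where "D = (\<chi> k. case k of None \<Rightarrow> - (\<Sum>i\<in>UNIV. d $ i) | Some i \<Rightarrow> d $ i)"
  define U where "U y = (\<chi> i. y $ Some i)" for y :: "real ^ 'n option"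
  have D_nth: "D $ None = - (\<Sum>i\<in>UNIV. d $ i)" "D $ Some i = d $ i" for i
    by (simp_all add: D_def)
  have "D \<in> convex_cone hull ((\<lambda>a. axis (fst a) 1 - axis (snd a) 1) ` ?A)"
  proof (rule weak_exchange_asymptotic_cone)
    show "weak_exchange (sum_lift ` T)" using weak_exchange_sum_lift[OF T(1)] .
    show "sum_lift x \<in> sum_lift ` T" using T(2) by blast
    show "(\<Sum>k\<in>UNIV. w $ k) = 0" if "w \<in> sum_lift ` T" for w using that by auto
    show "(\<Sum>k\<in>UNIV. D $ k) = 0" by (simp add: UNIV_option_conv sum.reindex D_nth)
    fix K :: nat
    obtain p where p: "p \<in> T" "\<And>i. \<bar>real_of_int (p $ i) - (real_vec x + real K *\<^sub>R d) $ i\<bar> \<le> 1"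
      using Mnat_hull_near[OF T(1) d] by blast
    have close: "\<bar>real_of_int (p $ i - x $ i) - real K * d $ i\<bar> \<le> 1" for i
      using p(2)[of i] by (simp add: algebra_simps)
    \<comment> \<open>Coordinate \<open>None\<close> adds up the errors of all other coordinates,
      which explains the constant \<open>CARD('n)\<close>.\<close>
    have "\<bar>real_of_int (sum_lift p $ k - sum_lift x $ k) - real K * D $ k\<bar> \<le> real CARD('n)" for k
    proof (cases k)
      case None
      have "\<bar>\<Sum>i\<in>UNIV. real_of_int (p $ i - x $ i) - real K * d $ i\<bar> \<le> (\<Sum>i\<in>(UNIV :: 'n set). 1 :: real)"
        by (rule order_trans[OF sum_abs sum_mono]) (rule close)
      also have "(\<Sum>i\<in>UNIV. real_of_int (p $ i - x $ i) - real K * d $ i) =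
          - (real_of_int (sum_lift p $ k - sum_lift x $ k) - real K * D $ k)"
        by (simp add: None D_nth sum_subtractf sum_distrib_left)
      finally show ?thesis by simp
    next
      case (Some i)
      have "1 \<le> real CARD('n)" by (simp add: Suc_le_eq)
      from order_trans[OF close[of i] this] show ?thesis by (simp add: Some D_nth)
    qed
    then show "\<exists>p\<in>sum_lift ` T. \<forall>k. \<bar>real_of_int (p $ k - sum_lift x $ k) - real K * D $ k\<bar> \<le> real CARD('n)"
      using p(1) by blast
  qed
  then have "U D \<in> U ` (convex_cone hull ((\<lambda>a. axis (fst a) 1 - axis (snd a) 1) ` ?A))" by blast
  moreover have "linear U" by (rule linearI) (simp_all add: U_def vec_eq_iff)
  ultimately have "U D \<in> convex_cone hull (U ` (\<lambda>a. axis (fst a) 1 - axis (snd a) 1) ` ?A)"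
    by (simp add: convex_cone_hull_linear_image)
  moreover have "U (axis (fst a) 1 - axis (snd a) 1) = real_vec (sum_unlift (exch_arc a))" for a
    by (simp add: U_def vec_eq_iff exch_arc_def axis_nth)
  moreover have "U D = d" by (simp add: U_def vec_eq_iff D_nth)
  ultimately show ?thesis by (simp add: image_image)
qed

lemma recession_hull_Int_Mnat:
  fixes T U :: "(int ^ 'n) set"
  assumes T: "Mnat_convex T" and U: "Mnat_convex U" and x: "x \<in> T \<inter> U"
    and poly: "polyhedron (convex hull (real_vec ` (T \<inter> U)))"
  shows "recession (convex hull (real_vec ` (T \<inter> U))) =
    convex hull (real_vec ` (Mnat_recession T x \<inter> Mnat_recession U x))"
proof
  let ?P = "convex hull (real_vec ` (T \<inter> U))"
  let ?R = "Mnat_recession T x \<inter> Mnat_recession U x"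
  have xP: "real_vec x \<in> ?P" using x by (simp add: hull_inc)
  show "convex hull (real_vec ` ?R) \<subseteq> recession ?P"
  proof (rule hull_minimal)
    show "convex (recession ?P)" using convex_cone_recession[of ?P] by (simp add: convex_cone_def)
    show "real_vec ` ?R \<subseteq> recession ?P"
    proof clarify
      fix r assume r: "r \<in> Mnat_recession T x" "r \<in> Mnat_recession U x"
      show "real_vec r \<in> recession ?P"
      proof (rule polyhedron_recessionI[OF poly xP])
        fix k :: nat
        have "x + int k *s r \<in> T \<inter> U"
          using Mnat_recession_step[OF T _ r(1)] Mnat_recession_step[OF U _ r(2)] x by simp
        then have "real_vec (x + int k *s r) \<in> ?P" by (simp add: hull_inc)
        also have "real_vec (x + int k *s r) = real_vec x + real k *\<^sub>R real_vec r" by (simp add: vec_eq_iff)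
        finally show "real_vec x + real k *\<^sub>R real_vec r \<in> ?P" .
      qed
    qed
  qed
  show "recession ?P \<subseteq> convex hull (real_vec ` ?R)"
  proof
    fix d assume d: "d \<in> recession ?P"
    have "real_vec x + real k *\<^sub>R d \<in> ?P" for k :: nat using recessionD_scaleR[OF d xP] by simp
    moreover have "?P \<subseteq> convex hull (real_vec ` T)" "?P \<subseteq> convex hull (real_vec ` U)"
      by (intro hull_mono; blast)+
    ultimately have "\<And>k::nat. real_vec x + real k *\<^sub>R d \<in> convex hull (real_vec ` T)"
      "\<And>k::nat. real_vec x + real k *\<^sub>R d \<in> convex hull (real_vec ` U)" by blast+
    then show "d \<in> convex hull (real_vec ` ?R)"
      unfolding Mnat_recession_def using x
      by (intro convex_cone_hull_Int_integral Mnat_asymptotic_direction T U) simp_all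
  qed
qed

section \<open>M-convex sets as M-natural-convex sets of constant sum, and the individual
  classes\<close>

lemma M_convex_imp_Mnat_convex: "M_convex T \<Longrightarrow> Mnat_convex T"
  unfolding M_convex_def Mnat_convex_def by meson

lemma M_convex_sum_eq:
  fixes T :: "(int ^ 'n) set"
  assumes T: "M_convex T" and "x \<in> T" "y \<in> T"
  shows "(\<Sum>k\<in>UNIV. x $ k) = (\<Sum>k\<in>UNIV. y $ k)"
  using assms(2,3)
proof (induction "nat (\<Sum>k\<in>UNIV. \<bar>x $ k - y $ k\<bar>)" arbitrary: x y rule: less_induct)
  case less
  have *: "(\<Sum>k\<in>UNIV. x $ k) = (\<Sum>k\<in>UNIV. y $ k)" if i: "x $ i > y $ i" for i
  proof -
    obtain j where j: "x $ j < y $ j" "x - axis i 1 + axis j 1 \<in> T"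
      using T less.prems i unfolding M_convex_def by blast
    have "(\<Sum>k\<in>UNIV. (x - axis i 1 + axis j 1) $ k) = (\<Sum>k\<in>UNIV. y $ k)"
      using less.hyps[OF exchange_closer[OF i j(1)] j(2) less.prems(2)] .
    then show ?thesis by (simp add: sum.distrib sum_subtractf)
  qed
  have **: "(\<Sum>k\<in>UNIV. x $ k) = (\<Sum>k\<in>UNIV. y $ k)" if i: "y $ i > x $ i" for i
  proof -
    obtain j where j: "y $ j < x $ j" using T less.prems i unfolding M_convex_def by blast
    then show ?thesis by (rule *)
  qed
  show ?case
  proof (cases "x = y")
    case False
    then obtain i where "x $ i \<noteq> y $ i" by (auto simp: vec_eq_iff)
    then show ?thesis using * ** by (meson linorder_neqE)
  qed simp
qed

text \<open>The constant coordinate sum on \<open>T\<close> forces sum 0 on its recession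
  directions, which rules out the uncompensated alternative of the M-natural axiom.\<close>

lemma M_convex_Mnat_recession:
  fixes T :: "(int ^ 'n) set"
  assumes T: "M_convex T" "x \<in> T"
  shows "M_convex (Mnat_recession T x)"
proof -
  let ?R = "Mnat_recession T x"
  have sum0: "(\<Sum>k\<in>UNIV. r $ k) = 0" if "r \<in> ?R" for r
  proof -
    have "x + int 1 *s r \<in> T" using Mnat_recession_step[OF M_convex_imp_Mnat_convex[OF T(1)] T(2) that] .
    from M_convex_sum_eq[OF T(1) this T(2)] show ?thesis by (simp add: sum.distrib)
  qed
  have "\<exists>j. r $ j < s $ j \<and> r - axis i 1 + axis j 1 \<in> ?R \<and> s + axis i 1 - axis j 1 \<in> ?R"
    if rs: "r \<in> ?R" "s \<in> ?R" "r $ i > s $ i" for r s i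
  proof -
    have "r - axis i 1 \<notin> ?R"
    proof
      assume "r - axis i 1 \<in> ?R"
      from sum0[OF this] sum0[OF rs(1)] show False by (simp add: sum_subtractf)
    qed
    then show ?thesis
      using Mnat_convex_Mnat_recession[of T x] rs unfolding Mnat_convex_def by blast
  qed
  then show ?thesis using Mnat_recession_0 unfolding M_convex_def by blast
qed

text \<open>The case \<open>U = T\<close> covers the classes of single sets.\<close>

lemma decomposable_Int:
  fixes T U :: "(int ^ 'n) set"
  assumes "polyhedron P" "P = convex hull (real_vec ` (T \<inter> U))" "Mnat_convex T" "Mnat_convex U" "x \<in> T \<inter> U"
    and "A (Mnat_recession T x \<inter> Mnat_recession U x)"
    and "\<And>b. T \<inter> U \<inter> int_box b \<noteq> {} \<Longrightarrow> A (T \<inter> U \<inter> int_box b)"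
  shows "decomposable A P"
  unfolding decomposable_def
  using assms by (intro decomposition_of_class[where S = "T \<inter> U" and R = "Mnat_recession T x \<inter> Mnat_recession U x"])
    (auto simp: recession_hull_Int_Mnat)

lemma Mnat_decomposable:
  assumes "polyhedron P" "convex_polyhedron_of Mnat_convex P"
  shows "decomposable Mnat_convex P"
proof -
  obtain T where T: "Mnat_convex T" "P = convex hull (real_vec ` T)"
    using assms(2) by (auto simp: convex_polyhedron_of_def)
  then obtain x where "x \<in> T" by (auto simp: Mnat_convex_def)
  then show ?thesis
    using assms(1) T Mnat_convex_Mnat_recession[of T x] Mnat_convex_Int_int_box[OF T(1)]
    by (intro decomposable_Int[of P T T x]) simp_all
qed

lemma M_decomposable:
  assumes "polyhedron P" "convex_polyhedron_of M_convex P"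
  shows "decomposable M_convex P"
proof -
  obtain T where T: "M_convex T" "P = convex hull (real_vec ` T)"
    using assms(2) by (auto simp: convex_polyhedron_of_def)
  then obtain x where "x \<in> T" by (auto simp: M_convex_def)
  then show ?thesis
    using assms(1) T M_convex_Mnat_recession[OF T(1)] M_convex_Int_int_box[OF T(1)] M_convex_imp_Mnat_convex[OF T(1)]
    by (intro decomposable_Int[of P T T x]) simp_all
qed

lemma Mnat2_decomposable:
  assumes "polyhedron P" "convex_polyhedron_of Mnat2_convex P"
  shows "decomposable Mnat2_convex P"
proof -
  obtain T U where TU: "Mnat_convex T" "Mnat_convex U" "T \<inter> U \<noteq> {}" "P = convex hull (real_vec ` (T \<inter> U))"
    using assms(2) by (auto simp: convex_polyhedron_of_def Mnat2_convex_def)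
  then obtain x where x: "x \<in> T \<inter> U" by blast
  have "Mnat2_convex (Mnat_recession T x \<inter> Mnat_recession U x)"
    unfolding Mnat2_convex_def using Mnat_convex_Mnat_recession Mnat_recession_0 by blast
  moreover have "Mnat2_convex (T \<inter> U \<inter> int_box b)" if b: "T \<inter> U \<inter> int_box b \<noteq> {}" for b
  proof -
    have "T \<inter> int_box b \<noteq> {}" "U \<inter> int_box b \<noteq> {}" using b by blast+
    then have "Mnat_convex (T \<inter> int_box b)" "Mnat_convex (U \<inter> int_box b)"
      using Mnat_convex_Int_int_box TU(1,2) by blast+
    moreover have "T \<inter> U \<inter> int_box b = (T \<inter> int_box b) \<inter> (U \<inter> int_box b)" by blast
    ultimately show ?thesis using b unfolding Mnat2_convex_def by blast
  qed
  ultimately show ?thesis using assms(1) TU x by (intro decomposable_Int[of P T U x]) simp_all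
qed

lemma M2_decomposable:
  assumes "polyhedron P" "convex_polyhedron_of M2_convex P"
  shows "decomposable M2_convex P"
proof -
  obtain T U where TU: "M_convex T" "M_convex U" "T \<inter> U \<noteq> {}" "P = convex hull (real_vec ` (T \<inter> U))"
    using assms(2) by (auto simp: convex_polyhedron_of_def M2_convex_def)
  then obtain x where x: "x \<in> T \<inter> U" by blast
  have "M_convex (Mnat_recession T x)" "M_convex (Mnat_recession U x)"
    using M_convex_Mnat_recession[of T x] M_convex_Mnat_recession[of U x] TU(1,2) x by simp_all
  then have "M2_convex (Mnat_recession T x \<inter> Mnat_recession U x)"
    unfolding M2_convex_def using Mnat_recession_0 by blast
  moreover have "M2_convex (T \<inter> U \<inter> int_box b)" if b: "T \<inter> U \<inter> int_box b \<noteq> {}" for b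
  proof -
    have "T \<inter> int_box b \<noteq> {}" "U \<inter> int_box b \<noteq> {}" using b by blast+
    then have "M_convex (T \<inter> int_box b)" "M_convex (U \<inter> int_box b)"
      using M_convex_Int_int_box TU(1,2) by blast+
    moreover have "T \<inter> U \<inter> int_box b = (T \<inter> int_box b) \<inter> (U \<inter> int_box b)" by blast
    ultimately show ?thesis using b unfolding M2_convex_def by blast
  qed
  ultimately show ?thesis
    using assms(1) TU(4) x M_convex_imp_Mnat_convex[OF TU(1)] M_convex_imp_Mnat_convex[OF TU(2)] by (intro decomposable_Int[of P T U x]) simp_all
qed

theorem theorem3p6:
  fixes P :: "(real ^ 'n::{finite,linorder}) set"
  assumes "polyhedron P"
  shows "
    (convex_polyhedron_of Lnat_convex P \<longrightarrow>
      (\<exists>Q C. convex_polyhedron_of Lnat_convex Q \<and> bounded Q \<and> convex_cone_of Lnat_convex C \<and>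
             P = {q + c | q c. q \<in> Q \<and> c \<in> C})) \<and>
    (convex_polyhedron_of Lnat2_convex P \<longrightarrow>
      (\<exists>Q C. convex_polyhedron_of Lnat2_convex Q \<and> bounded Q \<and> convex_cone_of Lnat2_convex C \<and>
             P = {q + c | q c. q \<in> Q \<and> c \<in> C})) \<and>
    (convex_polyhedron_of Mnat_convex P \<longrightarrow>
      (\<exists>Q C. convex_polyhedron_of Mnat_convex Q \<and> bounded Q \<and> convex_cone_of Mnat_convex C \<and>
             P = {q + c | q c. q \<in> Q \<and> c \<in> C})) \<and>
    (convex_polyhedron_of M_convex P \<longrightarrow>
      (\<exists>Q C. convex_polyhedron_of M_convex Q \<and> bounded Q \<and> convex_cone_of M_convex C \<and>
             P = {q + c | q c. q \<in> Q \<and> c \<in> C})) \<and>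
    (convex_polyhedron_of Mnat2_convex P \<longrightarrow>
      (\<exists>Q C. convex_polyhedron_of Mnat2_convex Q \<and> bounded Q \<and> convex_cone_of Mnat2_convex C \<and>
             P = {q + c | q c. q \<in> Q \<and> c \<in> C})) \<and>
    (convex_polyhedron_of M2_convex P \<longrightarrow>
      (\<exists>Q C. convex_polyhedron_of M2_convex Q \<and> bounded Q \<and> convex_cone_of M2_convex C \<and>
             P = {q + c | q c. q \<in> Q \<and> c \<in> C})) \<and>
    (convex_polyhedron_of multimodular P \<longrightarrow>
      (\<exists>Q C. convex_polyhedron_of multimodular Q \<and> bounded Q \<and> convex_cone_of multimodular C \<and>
             P = {q + c | q c. q \<in> Q \<and> c \<in> C}))"
  unfolding decomposable_def[symmetric]
  using Lnat_decomposable Lnat2_decomposable Mnat_decomposable[OF assms] M_decomposable[OF assms]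
    Mnat2_decomposable[OF assms] M2_decomposable[OF assms] multimodular_decomposable by blast

end
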